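(* Suppose that an amenable discrete group $\Gamma$ is the countable increasing union of subgroups $\Lambda_1\subseteq\Lambda_2\subseteq\dots\subseteq\Gamma$. If $\mathcal{X}\subseteq\mathrm{Sub}(\Gamma)$ is closed, conjugation-invariant, and such that $\Lambda_n\cap\mathcal{X}\in\mathcal{D}_{\Lambda_n}$ for all $n\in\mathbb{N}$, then $\mathcal{X}\in\mathcal{D}_\Gamma$. In particular, if all $\Lambda_n$ have the Density Property, then so does $\Gamma$.
   Context: For an amenable discrete group $\Gamma$, $\mathrm{Sub}(\Gamma)$ is the set of subgroups of $\Gamma$ with the Chabauty topology (the subspace topology from $\{0,1\}^\Gamma$ with the product topology via $X\mapsto\mathbbm{1}_X$). For $X\in\mathrm{Sub}(\Gamma)$, $\lambda_{\Gamma/X}$ is the quasi-regular representation on $\ell^2(\Gamma/X)$, $\lambda_{\Gamma/X}(g)\delta_{hX}=\delta_{ghX}$, extended to $C^*_r(\Gamma)=C^*(\Gamma)$. For $\mathcal{X}\subseteq\mathrm{Sub}(\Gamma)$, $J_{\Gamma,\mathcal{X}}:=\bigcap_{X\in\mathcal{X}}\ker(\lambda_{\Gamma/X})\trianglelefteq C^*_r(\Gamma)$. $\mathcal{D}_\Gamma$ is the set of all closed, conjugation-invariant $\mathcal{X}\subseteq\mathrm{Sub}(\Gamma)$ such that $J_{\Gamma,\mathcal{X}}\cap\mathbb{C}[\Gamma]$ is dense in $J_{\Gamma,\mathcal{X}}$. $\Gamma$ has the Density Property if $\mathcal{D}_\Gamma$ contains all closed conjugation-invariant sets of subgroups. For a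 subgroup $\Lambda\subseteq\Gamma$ and closed conjugation-invariant $\mathcal{X}\subseteq\mathrm{Sub}(\Gamma)$, $\Lambda\cap\mathcal{X}:=\{\Lambda\cap X: X\in\mathcal{X}\}$, which is a closed and conjugation-invariant subset of $\mathrm{Sub}(\Lambda)$. *)

theory Defs
  imports "HOL-Analysis.Analysis" "HOL-Algebra.Left_Coset"
begin

section \<open>The Hilbert space of square-summable functions\<close>

lemma square_summable_add:
  fixes f g :: "'i \<Rightarrow> complex"
  assumes "(\<lambda>x. (cmod (f x))\<^sup>2) summable_on A" and "(\<lambda>x. (cmod (g x))\<^sup>2) summable_on A"
  shows "(\<lambda>x. (cmod (f x + g x))\<^sup>2) summable_on A"
proof (rule summable_on_comparison_test)
  show "(\<lambda>x. 2 * (cmod (f x))\<^sup>2 + 2 * (cmod (g x))\<^sup>2) summable_on A"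
    by (intro summable_on_add summable_on_cmult_right assms)
  show "(cmod (f x + g x))\<^sup>2 \<le> 2 * (cmod (f x))\<^sup>2 + 2 * (cmod (g x))\<^sup>2" for x
  proof -
    have "(cmod (f x + g x))\<^sup>2 \<le> (cmod (f x) + cmod (g x))\<^sup>2"
      by (simp add: norm_triangle_ineq power_mono)
    also have "\<dots> \<le> 2 * (cmod (f x))\<^sup>2 + 2 * (cmod (g x))\<^sup>2"
      using sum_squares_bound[of "cmod (f x)" "cmod (g x)"] by (simp add: power2_sum)
    finally show ?thesis .
  qed
qed auto

lemma square_summable_cmult:
  fixes f :: "'i \<Rightarrow> complex"
  assumes "(\<lambda>x. (cmod (f x))\<^sup>2) summable_on A"
  shows "(\<lambda>x. (cmod (c * f x))\<^sup>2) summable_on A"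
  unfolding norm_mult power_mult_distrib by (intro summable_on_cmult_right assms)

lemma square_summable_inner:
  fixes f g :: "'i \<Rightarrow> complex"
  assumes "(\<lambda>x. (cmod (f x))\<^sup>2) summable_on A" and "(\<lambda>x. (cmod (g x))\<^sup>2) summable_on A"
  shows "(\<lambda>x. inner (f x) (g x)) summable_on A"
proof -
  have eq: "inner (f x) (g x) =
      (1/2) * ((cmod (f x + g x))\<^sup>2 + ((-1) * (cmod (f x))\<^sup>2 + (-1) * (cmod (g x))\<^sup>2))" for x
    by (simp add: power2_norm_eq_inner inner_add inner_commute)
  show ?thesis
    unfolding eq
    by (intro summable_on_cmult_right summable_on_add square_summable_add assms)
qed

typedef 'i ell2 = "{f :: 'i \<Rightarrow> complex. (\<lambda>x. (cmod (f x))\<^sup>2) summable_on UNIV}"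
  morphisms ell2_fun Abs_ell2
  by (rule exI[of _ "\<lambda>_. 0"]) simp

setup_lifting type_definition_ell2

lemma ell2_fun_summable [simp]: "(\<lambda>x. (cmod (ell2_fun f x))\<^sup>2) summable_on UNIV"
  using ell2_fun[of f] by simp

text \<open>The real inner product below is the real part of the usual complex one; the norm is
  the usual one.\<close>

instantiation ell2 :: (type) real_inner
begin

lift_definition zero_ell2 :: "'a ell2" is "\<lambda>_. 0" by simp
lift_definition plus_ell2 :: "'a ell2 \<Rightarrow> 'a ell2 \<Rightarrow> 'a ell2" is "\<lambda>f g x. f x + g x"
  by (rule square_summable_add)
lift_definition uminus_ell2 :: "'a ell2 \<Rightarrow> 'a ell2" is "\<lambda>f x. - f x" by simp
lift_definition minus_ell2 :: "'a ell2 \<Rightarrow> 'a ell2 \<Rightarrow> 'a ell2" is "\<lambda>f g x. f x - g x"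
proof -
  fix f g :: "'a \<Rightarrow> complex"
  assume "(\<lambda>x. (cmod (f x))\<^sup>2) summable_on UNIV" "(\<lambda>x. (cmod (g x))\<^sup>2) summable_on UNIV"
  then show "(\<lambda>x. (cmod (f x - g x))\<^sup>2) summable_on UNIV"
    using square_summable_add[of f UNIV "\<lambda>x. - g x"] by simp
qed
lift_definition scaleR_ell2 :: "real \<Rightarrow> 'a ell2 \<Rightarrow> 'a ell2" is "\<lambda>r f x. complex_of_real r * f x"
  by (rule square_summable_cmult)

definition inner_ell2 :: "'a ell2 \<Rightarrow> 'a ell2 \<Rightarrow> real"
  where "inner_ell2 f g = (\<Sum>\<^sub>\<infinity>x. inner (ell2_fun f x) (ell2_fun g x))"
definition norm_ell2 :: "'a ell2 \<Rightarrow> real"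
  where "norm_ell2 f = sqrt (\<Sum>\<^sub>\<infinity>x. (cmod (ell2_fun f x))\<^sup>2)"
definition dist_ell2 :: "'a ell2 \<Rightarrow> 'a ell2 \<Rightarrow> real"
  where "dist_ell2 f g = norm (f - g)"
definition sgn_ell2 :: "'a ell2 \<Rightarrow> 'a ell2"
  where "sgn_ell2 f = scaleR (inverse (norm f)) f"
definition uniformity_ell2 :: "('a ell2 \<times> 'a ell2) filter"
  where "uniformity_ell2 = (INF e\<in>{0<..}. principal {(f, g). dist f g < e})"
definition open_ell2 :: "'a ell2 set \<Rightarrow> bool"
  where "open_ell2 U \<longleftrightarrow> (\<forall>x\<in>U. eventually (\<lambda>(x', y). x' = x \<longrightarrow> y \<in> U) uniformity)"

instance
proof
  fix f g h :: "'a ell2" and r s :: real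
  show "f + g + h = f + (g + h)" "f + g = g + f" "0 + f = f" "- f + f = 0" "f - g = f + - g"
    "r *\<^sub>R (f + g) = r *\<^sub>R f + r *\<^sub>R g" "(r + s) *\<^sub>R f = r *\<^sub>R f + s *\<^sub>R f"
    "r *\<^sub>R s *\<^sub>R f = (r * s) *\<^sub>R f" "1 *\<^sub>R f = f"
    by (transfer; simp add: algebra_simps)+
  show "dist f g = norm (f - g)" by (rule dist_ell2_def)
  show "sgn f = scaleR (inverse (norm f)) f" by (rule sgn_ell2_def)
  show "uniformity = (INF e\<in>{0<..}. principal {(f :: 'a ell2, g). dist f g < e})"
    by (rule uniformity_ell2_def)
  show "open U = (\<forall>x\<in>U. eventually (\<lambda>(x', y). x' = x \<longrightarrow> y \<in> U) uniformity)"
    for U :: "'a ell2 set" by (rule open_ell2_def)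
  show "inner f g = inner g f"
    by (simp add: inner_ell2_def inner_commute)
  show "inner (f + g) h = inner f h + inner g h"
    unfolding inner_ell2_def plus_ell2.rep_eq inner_add_left
    by (intro infsum_add square_summable_inner ell2_fun_summable)
  show "inner (r *\<^sub>R f) g = r * inner f g"
    unfolding inner_ell2_def scaleR_ell2.rep_eq
    by (simp add: infsum_cmult_right' flip: scaleR_conv_of_real)
  have sq: "inner f f = (\<Sum>\<^sub>\<infinity>x. (cmod (ell2_fun f x))\<^sup>2)"
    by (simp add: inner_ell2_def power2_norm_eq_inner)
  show "0 \<le> inner f f"
    unfolding sq by (intro infsum_nonneg) simp
  show "norm f = sqrt (inner f f)"
    unfolding sq norm_ell2_def ..
  show "inner f f = 0 \<longleftrightarrow> f = 0"
  proof
    assume "inner f f = 0"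
    then have "(cmod (ell2_fun f x))\<^sup>2 = 0" for x
      by (intro nonneg_infsum_le_0D[of "\<lambda>x. (cmod (ell2_fun f x))\<^sup>2" UNIV]) (auto simp: sq)
    then show "f = 0"
      by (intro ell2_fun_inject[THEN iffD1] ext) (simp add: zero_ell2.rep_eq)
  next
    assume "f = 0"
    then show "inner f f = 0" unfolding sq by (simp add: zero_ell2.rep_eq)
  qed
qed

end

lift_definition delta :: "'i \<Rightarrow> 'i ell2" is "\<lambda>x y. if y = x then 1 else 0"
proof -
  fix x :: 'i
  have "((\<lambda>y. (cmod (if y = x then 1 else 0))\<^sup>2) summable_on UNIV) =
      ((\<lambda>y. 1 :: real) summable_on {x})"
    by (rule summable_on_cong_neutral) auto
  then show "(\<lambda>y. (cmod (if y = x then 1 else 0))\<^sup>2) summable_on UNIV" by simp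
qed

lift_definition cscale_ell2 :: "complex \<Rightarrow> 'i ell2 \<Rightarrow> 'i ell2" is "\<lambda>c f x. c * f x"
  by (rule square_summable_cmult)

lemma norm_cscale_ell2: "norm (cscale_ell2 c f) = cmod c * norm f"
  by (simp add: norm_ell2_def cscale_ell2.rep_eq norm_mult power_mult_distrib
      infsum_cmult_right' real_sqrt_mult)

lift_definition cscale :: "complex \<Rightarrow> 'i ell2 \<Rightarrow>\<^sub>L 'i ell2" is cscale_ell2
proof (rule bounded_linear_intro)
  fix c :: complex and f g :: "'i ell2" and r :: real
  show "cscale_ell2 c (f + g) = cscale_ell2 c f + cscale_ell2 c g"
    "cscale_ell2 c (r *\<^sub>R f) = r *\<^sub>R cscale_ell2 c f"
    by (transfer; simp add: algebra_simps)+
  show "norm (cscale_ell2 c f) \<le> norm f * cmod c"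
    by (simp add: norm_cscale_ell2 mult.commute)
qed


section \<open>Regular and quasi-regular representations\<close>

text \<open>For a subset \<open>S\<close> of the index type, \<open>\<ell>\<^sup>2(S)\<close> is identified with the functions in
  \<^typ>\<open>'i ell2\<close> vanishing outside \<open>S\<close>, and an operator on \<open>\<ell>\<^sup>2(S)\<close> with its extension by zero
  on the orthogonal complement; this preserves sums, products, adjoints and norms.  The
  operator \<open>perm_op S \<sigma>\<close> is the composition operator \<open>f \<mapsto> f \<circ> \<sigma>\<close> on \<open>\<ell>\<^sup>2(S)\<close>. It is only
  used for \<open>\<sigma>\<close> a permutation of \<open>S\<close>; the guard makes it a bounded operator for every \<open>\<sigma>\<close>.\<close>

lift_definition perm_ell2 :: "'i set \<Rightarrow> ('i \<Rightarrow> 'i) \<Rightarrow> 'i ell2 \<Rightarrow> 'i ell2"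
  is "\<lambda>S \<sigma> f x. if inj_on \<sigma> S \<and> x \<in> S then f (\<sigma> x) else 0"
proof -
  fix S :: "'i set" and \<sigma> and f :: "'i \<Rightarrow> complex"
  assume f: "(\<lambda>x. (cmod (f x))\<^sup>2) summable_on UNIV"
  show "(\<lambda>x. (cmod (if inj_on \<sigma> S \<and> x \<in> S then f (\<sigma> x) else 0))\<^sup>2) summable_on UNIV"
  proof (cases "inj_on \<sigma> S")
    case True
    have "(\<lambda>x. (cmod (f x))\<^sup>2) summable_on \<sigma> ` S"
      using f by (rule summable_on_subset_banach) simp
    then have "(\<lambda>x. (cmod (f (\<sigma> x)))\<^sup>2) summable_on S"
      by (simp add: summable_on_reindex[OF True] o_def)
    then show ?thesis
      by (subst summable_on_cong_neutral[where T = S and g = "\<lambda>x. (cmod (f (\<sigma> x)))\<^sup>2"])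
        (auto simp: True)
  qed simp
qed

lemma norm_perm_ell2_le: "norm (perm_ell2 S \<sigma> f) \<le> norm f"
proof (cases "inj_on \<sigma> S")
  case True
  have "(\<Sum>\<^sub>\<infinity>x. (cmod (ell2_fun (perm_ell2 S \<sigma> f) x))\<^sup>2) = (\<Sum>\<^sub>\<infinity>x\<in>S. (cmod (ell2_fun f (\<sigma> x)))\<^sup>2)"
    by (rule infsum_cong_neutral) (auto simp: perm_ell2.rep_eq True)
  also have "\<dots> = (\<Sum>\<^sub>\<infinity>x\<in>\<sigma> ` S. (cmod (ell2_fun f x))\<^sup>2)"
    by (simp add: infsum_reindex[OF True] o_def)
  also have "\<dots> \<le> (\<Sum>\<^sub>\<infinity>x. (cmod (ell2_fun f x))\<^sup>2)"
    by (intro infsum_mono_neutral summable_on_subset_banach[OF ell2_fun_summable]) auto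
  finally show ?thesis by (simp add: norm_ell2_def)
next
  case False
  then have "perm_ell2 S \<sigma> f = 0"
    by (intro ell2_fun_inject[THEN iffD1] ext) (simp add: perm_ell2.rep_eq zero_ell2.rep_eq)
  then show ?thesis by simp
qed

lift_definition perm_op :: "'i set \<Rightarrow> ('i \<Rightarrow> 'i) \<Rightarrow> 'i ell2 \<Rightarrow>\<^sub>L 'i ell2" is perm_ell2
proof (rule bounded_linear_intro)
  fix S and \<sigma> :: "'i \<Rightarrow> 'i" and f g :: "'i ell2" and r :: real
  show "perm_ell2 S \<sigma> (f + g) = perm_ell2 S \<sigma> f + perm_ell2 S \<sigma> g"
    "perm_ell2 S \<sigma> (r *\<^sub>R f) = r *\<^sub>R perm_ell2 S \<sigma> f"
    by (transfer; auto)+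
  show "norm (perm_ell2 S \<sigma> f) \<le> norm f * 1"
    by (simp add: norm_perm_ell2_le)
qed

definition left_regular :: "('a, 'b) monoid_scheme \<Rightarrow> 'a \<Rightarrow> 'a ell2 \<Rightarrow>\<^sub>L 'a ell2"
  where "left_regular G g = perm_op (carrier G) (\<lambda>h. inv\<^bsub>G\<^esub> g \<otimes>\<^bsub>G\<^esub> h)"

definition quasi_regular ::
  "('a, 'b) monoid_scheme \<Rightarrow> 'a set \<Rightarrow> 'a \<Rightarrow> 'a set ell2 \<Rightarrow>\<^sub>L 'a set ell2"
  where "quasi_regular G X g = perm_op (lcosets\<^bsub>G\<^esub> X) (\<lambda>C. inv\<^bsub>G\<^esub> g <#\<^bsub>G\<^esub> C)"

lemma perm_op_delta:
  assumes "bij_betw \<sigma> S S" "x \<in> S"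
  shows "blinfun_apply (perm_op S \<sigma>) (delta (\<sigma> x)) = delta x"
  using assms
  by (intro ell2_fun_inject[THEN iffD1] ext)
    (auto simp: perm_op.rep_eq perm_ell2.rep_eq delta.rep_eq bij_betw_def inj_on_eq_iff)

lemma left_regular_delta:
  assumes "group G" "g \<in> carrier G" "h \<in> carrier G"
  shows "blinfun_apply (left_regular G g) (delta h) = delta (g \<otimes>\<^bsub>G\<^esub> h)"
proof -
  interpret group G by fact
  have "bij_betw (\<lambda>h. inv\<^bsub>G\<^esub> g \<otimes>\<^bsub>G\<^esub> h) (carrier G) (carrier G)"
    by (rule bij_betw_byWitness[where f' = "\<lambda>h. g \<otimes>\<^bsub>G\<^esub> h"])
      (use assms(2) in \<open>auto simp flip: m_assoc\<close>)
  from perm_op_delta[OF this, of "g \<otimes>\<^bsub>G\<^esub> h"] show ?thesis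
    using assms(2,3) by (simp add: left_regular_def flip: m_assoc)
qed

lemma quasi_regular_delta:
  assumes "group G" "subgroup X G" "g \<in> carrier G" "h \<in> carrier G"
  shows "blinfun_apply (quasi_regular G X g) (delta (h <#\<^bsub>G\<^esub> X)) = delta ((g \<otimes>\<^bsub>G\<^esub> h) <#\<^bsub>G\<^esub> X)"
proof -
  interpret group G by fact
  have X: "X \<subseteq> carrier G" using assms(2) by (rule subgroup.subset)
  have trans: "a <#\<^bsub>G\<^esub> (b <#\<^bsub>G\<^esub> X) = (a \<otimes>\<^bsub>G\<^esub> b) <#\<^bsub>G\<^esub> X"
    if "a \<in> carrier G" "b \<in> carrier G" for a b
    using lcos_m_assoc[OF X that] .
  have lcosets_image: "lcosets\<^bsub>G\<^esub> X = (\<lambda>a. a <#\<^bsub>G\<^esub> X) ` carrier G"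
    by (auto simp: LCOSETS_def)
  have mem: "(a \<otimes>\<^bsub>G\<^esub> b) <#\<^bsub>G\<^esub> X \<in> (\<lambda>a. a <#\<^bsub>G\<^esub> X) ` carrier G"
    if "a \<in> carrier G" "b \<in> carrier G" for a b
    using that by auto
  have "bij_betw (\<lambda>C. inv\<^bsub>G\<^esub> g <#\<^bsub>G\<^esub> C) (lcosets\<^bsub>G\<^esub> X) (lcosets\<^bsub>G\<^esub> X)"
    by (rule bij_betw_byWitness[where f' = "\<lambda>C. g <#\<^bsub>G\<^esub> C"])
      (use assms(3) mem in \<open>auto simp: lcosets_image trans simp flip: m_assoc\<close>)
  from perm_op_delta[OF this, of "(g \<otimes>\<^bsub>G\<^esub> h) <#\<^bsub>G\<^esub> X"] show ?thesis
    using assms(3,4) by (auto simp: quasi_regular_def LCOSETS_def trans simp flip: m_assoc)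
qed


section \<open>The reduced group C*-algebra\<close>

definition group_algebra :: "('a, 'b) monoid_scheme \<Rightarrow> ('a \<Rightarrow> complex) set"
  where "group_algebra G = {a. finite {g. a g \<noteq> 0} \<and> {g. a g \<noteq> 0} \<subseteq> carrier G}"

definition algebra_rep ::
  "('a \<Rightarrow> 'i ell2 \<Rightarrow>\<^sub>L 'i ell2) \<Rightarrow> ('a \<Rightarrow> complex) \<Rightarrow> 'i ell2 \<Rightarrow>\<^sub>L 'i ell2"
  where "algebra_rep \<pi> a = (\<Sum>g | a g \<noteq> 0. cscale (a g) o\<^sub>L \<pi> g)"

text \<open>The copy of the group algebra inside the bounded operators on \<open>\<ell>\<^sup>2\<close> of the group.\<close>

definition group_algebra_ops :: "('a, 'b) monoid_scheme \<Rightarrow> ('a ell2 \<Rightarrow>\<^sub>L 'a ell2) set"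
  where "group_algebra_ops G = algebra_rep (left_regular G) ` group_algebra G"

definition reduced_cstar :: "('a, 'b) monoid_scheme \<Rightarrow> ('a ell2 \<Rightarrow>\<^sub>L 'a ell2) set"
  where "reduced_cstar G = closure (group_algebra_ops G)"

text \<open>The extension of the quasi-regular representation from the group algebra to the reduced
  group C*-algebra.  It exists when \<open>G\<close> is amenable, because then every unitary representation is
  weakly contained in the regular one; as the group algebra is dense, continuity determines it on
  \<^term>\<open>reduced_cstar G\<close>.  Its values elsewhere are irrelevant and never used.\<close>

definition quasi_regular_ext ::
  "('a, 'b) monoid_scheme \<Rightarrow> 'a set \<Rightarrow> ('a ell2 \<Rightarrow>\<^sub>L 'a ell2) \<Rightarrow> 'a set ell2 \<Rightarrow>\<^sub>L 'a set ell2"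
  where "quasi_regular_ext G X = (SOME \<phi>. continuous_on (reduced_cstar G) \<phi> \<and>
    (\<forall>a \<in> group_algebra G.
      \<phi> (algebra_rep (left_regular G) a) = algebra_rep (quasi_regular G X) a))"

definition quasi_regular_kernel ::
  "('a, 'b) monoid_scheme \<Rightarrow> 'a set \<Rightarrow> ('a ell2 \<Rightarrow>\<^sub>L 'a ell2) set"
  where "quasi_regular_kernel G X = {T \<in> reduced_cstar G. quasi_regular_ext G X T = 0}"

text \<open>The intersection is taken inside the reduced group C*-algebra, which matters only for empty
  \<open>\<X>\<close>.\<close>

definition J_ideal :: "('a, 'b) monoid_scheme \<Rightarrow> 'a set set \<Rightarrow> ('a ell2 \<Rightarrow>\<^sub>L 'a ell2) set"
  where "J_ideal G \<X> = reduced_cstar G \<inter> (\<Inter>X\<in>\<X>. quasi_regular_kernel G X)"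


section \<open>Amenability, the Chabauty topology and the Density Property\<close>

text \<open>Existence of a left-invariant mean on the bounded real functions on the group.  A function
  on the group is represented by any function on the type; positivity and linearity force \<open>m f\<close>
  to depend only on \<open>f\<close> restricted to the carrier.\<close>

definition amenable :: "('a, 'b) monoid_scheme \<Rightarrow> bool"
  where "amenable G \<longleftrightarrow> (\<exists>m :: ('a \<Rightarrow> real) \<Rightarrow> real.
    (\<forall>f g. bounded (f ` carrier G) \<and> bounded (g ` carrier G) \<longrightarrow> m (\<lambda>x. f x + g x) = m f + m g) \<and>
    (\<forall>c f. bounded (f ` carrier G) \<longrightarrow> m (\<lambda>x. c * f x) = c * m f) \<and>
    (\<forall>f. bounded (f ` carrier G) \<and> (\<forall>x\<in>carrier G. 0 \<le> f x) \<longrightarrow> 0 \<le> m f) \<and>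
    m (\<lambda>_. 1) = 1 \<and>
    (\<forall>g\<in>carrier G. \<forall>f. bounded (f ` carrier G) \<longrightarrow> m (\<lambda>x. f (g \<otimes>\<^bsub>G\<^esub> x)) = m f))"

definition chabauty :: "('a, 'b) monoid_scheme \<Rightarrow> 'a set topology"
  where "chabauty G = pullback_topology {X. subgroup X G}
    (\<lambda>X. restrict (indicator X) (carrier G))
    (product_topology (\<lambda>_. discrete_topology {0, 1 :: nat}) (carrier G))"

lemma topspace_chabauty: "topspace (chabauty G) = {X. subgroup X G}"
  by (auto simp: chabauty_def topspace_pullback_topology indicator_def)

definition conjugation_invariant :: "('a, 'b) monoid_scheme \<Rightarrow> 'a set set \<Rightarrow> bool"
  where "conjugation_invariant G \<X> \<longleftrightarrow>
    (\<forall>X\<in>\<X>. \<forall>g\<in>carrier G. g <#\<^bsub>G\<^esub> X #>\<^bsub>G\<^esub> inv\<^bsub>G\<^esub> g \<in> \<X>)"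

definition density_sets :: "('a, 'b) monoid_scheme \<Rightarrow> 'a set set set"
  where "density_sets G = {\<X>. closedin (chabauty G) \<X> \<and> conjugation_invariant G \<X> \<and>
    J_ideal G \<X> \<subseteq> closure (J_ideal G \<X> \<inter> group_algebra_ops G)}"

definition density_property :: "('a, 'b) monoid_scheme \<Rightarrow> bool"
  where "density_property G \<longleftrightarrow>
    (\<forall>\<X>. closedin (chabauty G) \<X> \<and> conjugation_invariant G \<X> \<longrightarrow> \<X> \<in> density_sets G)"

end

theory Submission
  imports Defs "HOL-Analysis.Finite_Function_Topology"
begin

text \<open>Let \<open>T\<close> lie in the ideal of \<open>\<X>\<close> and let \<open>a \<in> \<complex>[\<Lambda>\<^sub>n]\<close> be close to \<open>T\<close>. Then \<open>a\<close> has small norm in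
  every representation on \<open>G/X\<close>, hence in its subrepresentation on \<open>\<Lambda>\<^sub>n/(\<Lambda>\<^sub>n \<inter> X)\<close>, so small norm modulo the
  ideal of \<open>\<Lambda>\<^sub>n \<inter> \<X>\<close>. As quotient norms of C*-algebras are attained by lifting, \<open>a\<close> is close to that
  ideal, and by assumption to an element \<open>b\<close> of its intersection with \<open>\<complex>[\<Lambda>\<^sub>n]\<close>. Conjugation invariance
  and the orbit decomposition of \<open>G/X\<close> under \<open>\<Lambda>\<^sub>n\<close> show that \<open>b\<close> lies in the ideal of \<open>\<X>\<close>, and the inclusion
  of reduced C*-algebras is isometric, so \<open>b\<close> is close to \<open>T\<close>.

  The lifting avoids functional calculus: if \<open>\<parallel>a\<parallel> \<le> R\<close> and \<open>\<parallel>\<pi>(a)\<parallel> \<le> \<epsilon>\<close>, then \<open>a (1 - a\<^sup>* a / R\<^sup>2)\<^sup>N\<close> with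
  \<open>N \<approx> R\<^sup>2 / (2 \<epsilon>\<^sup>2)\<close> has norm at most \<open>2 \<epsilon>\<close> and differs from \<open>a\<close> by at most \<open>\<epsilon> / 2\<close> under \<open>\<pi>\<close>; subtract
  and iterate.\<close>

section \<open>Completeness of \<open>\<ell>\<^sup>2\<close>\<close>

text \<open>The reduced C*-algebra is handled through norm inequalities in the group algebra,
  because the choice \<open>quasi_regular_ext\<close> says nothing until the quasi-regular norm is
  known to be dominated by the regular one. Amenability is given as an invariant mean, so this
  domination has to be derived: a Hahn-Banach separation yields almost invariant unit vectors, and
  tensoring with them compares any action with a free one. Regular, quasi-regular and diagonal
  representations and their restrictions to subgroups are all permutation representations. Two facts
  about orbits (one orbit bounds the norm from below, all orbits together from above) give the
  isometric inclusion, Fell absorption and both passages between \<open>\<Lambda>\<^sub>n\<close>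
  and the group. The exponent \<open>N\<close> balances two demands: a large \<open>N\<close>
  shrinks the product in the regular representation, where only \<open>R\<close> bounds
  \<open>a\<close>; a small \<open>N\<close> keeps it close to \<open>a\<close> where the norm is at
  most \<epsilon>. One halving costs 2 \<epsilon>, so the iteration costs 2 \<epsilon> + \<epsilon>
  + \<epsilon> / 2 + ... = 4 \<epsilon>.\<close>

lemma ell2_eqI: "(\<And>x. ell2_fun f x = ell2_fun g x) \<Longrightarrow> f = g"
  by (intro ell2_fun_inject[THEN iffD1] ext)

lemma norm_ell2_power2: "(norm f)\<^sup>2 = (\<Sum>\<^sub>\<infinity>x. (cmod (ell2_fun f x))\<^sup>2)"
  unfolding norm_ell2_def by (intro real_sqrt_pow2 infsum_nonneg) simp

lemma sum_le_norm_ell2: "finite A \<Longrightarrow> (\<Sum>x\<in>A. (cmod (ell2_fun f x))\<^sup>2) \<le> (norm f)\<^sup>2"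
  unfolding norm_ell2_power2 by (intro finite_sum_le_infsum) auto

lemma cmod_ell2_fun_le: "cmod (ell2_fun f x) \<le> norm f"
  using sum_le_norm_ell2[of "{x}" f] by (simp add: power2_le_iff_abs_le)

lemma norm_ell2_leI:
  assumes "0 \<le> B" and "\<And>A. finite A \<Longrightarrow> (\<Sum>x\<in>A. (cmod (ell2_fun f x))\<^sup>2) \<le> B\<^sup>2"
  shows "norm f \<le> B"
proof -
  have "(norm f)\<^sup>2 \<le> B\<^sup>2"
    unfolding norm_ell2_power2 by (intro infsum_le_finite_sums) (auto intro: assms(2))
  then show ?thesis using assms(1) by (rule power2_le_imp_le)
qed

text \<open>A uniform bound on finite sums is how the limit of a Cauchy sequence and the square root
  of a probability vector are recognized as square-summable.\<close>

lemma ell2_fun_Abs: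
  assumes "\<And>A. finite A \<Longrightarrow> (\<Sum>x\<in>A. (cmod (h x))\<^sup>2) \<le> B"
  shows "ell2_fun (Abs_ell2 h) = h"
proof -
  have "(\<lambda>x. (cmod (h x))\<^sup>2) summable_on UNIV"
    by (rule nonneg_bdd_above_summable_on) (auto intro!: bdd_aboveI[of _ B] assms)
  then show ?thesis by (simp add: Abs_ell2_inverse)
qed

text \<open>Completeness of the target passes to bounded operators. It is what lets uniformly
  continuous operator-valued maps extend to a closure and makes absolutely convergent series of
  operators converge.\<close>

instance ell2 :: (type) complete_space
proof
  fix X :: "nat \<Rightarrow> 'a ell2"
  assume X: "Cauchy X"
  have "Cauchy (\<lambda>n. ell2_fun (X n) i)" for i
  proof (rule metric_CauchyI)
    fix e :: real assume "0 < e"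
    then obtain M where M: "\<And>m n. m \<ge> M \<Longrightarrow> n \<ge> M \<Longrightarrow> norm (X m - X n) < e"
      using CauchyD[OF X] by blast
    have "dist (ell2_fun (X m) i) (ell2_fun (X n) i) < e" if "m \<ge> M" "n \<ge> M" for m n
      using M[OF that] cmod_ell2_fun_le[of "X m - X n" i] by (simp add: dist_norm minus_ell2.rep_eq)
    then show "\<exists>M. \<forall>m\<ge>M. \<forall>n\<ge>M. dist (ell2_fun (X m) i) (ell2_fun (X n) i) < e" by blast
  qed
  then obtain F where F: "\<And>i. (\<lambda>n. ell2_fun (X n) i) \<longlonglongrightarrow> F i"
    unfolding Cauchy_convergent_iff convergent_def by metis
  \<comment> \<open>Fatou's lemma in finite form: on a finite set \<open>A\<close> the Cauchy bound
    survives the pointwise limit in \<open>m\<close>, with a constant that does not depend on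
    \<open>A\<close>.\<close>
  have tail: "(\<Sum>i\<in>A. (cmod (ell2_fun (X n) i - F i))\<^sup>2) \<le> e\<^sup>2"
    if "finite A" "n \<ge> M" and M: "\<And>m n. m \<ge> M \<Longrightarrow> n \<ge> M \<Longrightarrow> norm (X m - X n) < e" for A M n e
  proof (rule LIMSEQ_le_const2)
    show "(\<lambda>m. \<Sum>i\<in>A. (cmod (ell2_fun (X n - X m) i))\<^sup>2) \<longlonglongrightarrow> (\<Sum>i\<in>A. (cmod (ell2_fun (X n) i - F i))\<^sup>2)"
      unfolding minus_ell2.rep_eq by (intro tendsto_intros F)
    have "(\<Sum>i\<in>A. (cmod (ell2_fun (X n - X m) i))\<^sup>2) \<le> e\<^sup>2" if "m \<ge> M" for m
    proof -
      have "(norm (X n - X m))\<^sup>2 \<le> e\<^sup>2"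
        using M[OF \<open>n \<ge> M\<close> that] by (intro power_mono) auto
      then show ?thesis
        using sum_le_norm_ell2[OF \<open>finite A\<close>] order_trans by blast
    qed
    then show "\<exists>N. \<forall>m\<ge>N. (\<Sum>i\<in>A. (cmod (ell2_fun (X n - X m) i))\<^sup>2) \<le> e\<^sup>2" by blast
  qed
  obtain M1 where M1: "\<And>m n. m \<ge> M1 \<Longrightarrow> n \<ge> M1 \<Longrightarrow> norm (X m - X n) < 1"
    using CauchyD[OF X, of 1] by auto
  \<comment> \<open>Square-summability of the pointwise limit \<open>F\<close> is not yet known, but
    its difference from \<open>X M1\<close> is bounded by 1; the limit is therefore written as
    \<open>X M1 - D\<close>.\<close>
  define D where "D = Abs_ell2 (\<lambda>i. ell2_fun (X M1) i - F i)"
  have D: "ell2_fun D = (\<lambda>i. ell2_fun (X M1) i - F i)"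
    unfolding D_def by (rule ell2_fun_Abs[of _ "1\<^sup>2"]) (rule tail[OF _ order_refl M1])
  have "X \<longlonglongrightarrow> X M1 - D"
  proof (rule metric_LIMSEQ_I)
    fix e :: real assume "0 < e"
    then obtain M where M: "\<And>m n. m \<ge> M \<Longrightarrow> n \<ge> M \<Longrightarrow> norm (X m - X n) < e / 2"
      using CauchyD[OF X, of "e / 2"] by auto
    have "norm (X n - (X M1 - D)) \<le> e / 2" if "n \<ge> M" for n
      using \<open>0 < e\<close> tail[OF _ that M] by (intro norm_ell2_leI) (auto simp: minus_ell2.rep_eq D)
    then have "dist (X n) (X M1 - D) < e" if "n \<ge> M" for n
      by (smt (verit) \<open>0 < e\<close> that dist_norm field_sum_of_halves)
    then show "\<exists>no. \<forall>n\<ge>no. dist (X n) (X M1 - D) < e" by blast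
  qed
  then show "convergent X" by (rule convergentI)
qed

instance ell2 :: (type) banach ..

section \<open>Representations from group actions\<close>

text \<open>A version of \<open>perm_ell2\<close> between two index types, needed to compare
  functions on cosets with functions on an orbit. The guard makes it a contraction for every
  \<theta>.\<close>

lift_definition pull_ell2 :: "'j set \<Rightarrow> ('j \<Rightarrow> 'i) \<Rightarrow> 'i ell2 \<Rightarrow> 'j ell2"
  is "\<lambda>A \<theta> f x. if inj_on \<theta> A \<and> x \<in> A then f (\<theta> x) else 0"
proof -
  fix A :: "'j set" and \<theta> and f :: "'i \<Rightarrow> complex"
  assume f: "(\<lambda>x. (cmod (f x))\<^sup>2) summable_on UNIV"
  show "(\<lambda>x. (cmod (if inj_on \<theta> A \<and> x \<in> A then f (\<theta> x) else 0))\<^sup>2) summable_on UNIV"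
  proof (cases "inj_on \<theta> A")
    case True
    have "(\<lambda>x. (cmod (f x))\<^sup>2) summable_on \<theta> ` A"
      using f by (rule summable_on_subset_banach) simp
    then have "(\<lambda>x. (cmod (f (\<theta> x)))\<^sup>2) summable_on A"
      by (simp add: summable_on_reindex[OF True] o_def)
    then show ?thesis
      by (subst summable_on_cong_neutral[where T = A and g = "\<lambda>x. (cmod (f (\<theta> x)))\<^sup>2"])
        (auto simp: True)
  qed simp
qed

lemma norm_pull_ell2_le: "norm (pull_ell2 A \<theta> f) \<le> norm f"
proof (cases "inj_on \<theta> A")
  case True
  show ?thesis
  proof (rule norm_ell2_leI)
    fix F :: "'a set" assume F: "finite F"
    have "(\<Sum>x\<in>F. (cmod (ell2_fun (pull_ell2 A \<theta> f) x))\<^sup>2) = (\<Sum>x\<in>F \<inter> A. (cmod (ell2_fun f (\<theta> x)))\<^sup>2)"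
      using F by (intro sum.mono_neutral_cong_right) (auto simp: pull_ell2.rep_eq True)
    also have "\<dots> = (\<Sum>y\<in>\<theta> ` (F \<inter> A). (cmod (ell2_fun f y))\<^sup>2)"
      by (subst sum.reindex) (auto intro: inj_on_subset[OF True])
    also have "\<dots> \<le> (norm f)\<^sup>2" using F by (intro sum_le_norm_ell2) auto
    finally show "(\<Sum>x\<in>F. (cmod (ell2_fun (pull_ell2 A \<theta> f) x))\<^sup>2) \<le> (norm f)\<^sup>2" .
  qed simp
next
  case False
  then have "pull_ell2 A \<theta> f = 0"
    by (intro ell2_eqI) (simp add: pull_ell2.rep_eq zero_ell2.rep_eq)
  then show ?thesis by simp
qed

section \<open>Linear extension of representations to the group algebra\<close>

lemma ell2_fun_sum: "ell2_fun (\<Sum>i\<in>I. f i) x = (\<Sum>i\<in>I. ell2_fun (f i) x)"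
  by (induction I rule: infinite_finite_induct) (simp_all add: zero_ell2.rep_eq plus_ell2.rep_eq)

lemma algebra_rep_apply:
  "blinfun_apply (algebra_rep \<pi> a) f = (\<Sum>g | a g \<noteq> 0. cscale_ell2 (a g) (blinfun_apply (\<pi> g) f))"
  by (simp add: algebra_rep_def blinfun.sum_left cscale.rep_eq)

text \<open>The sum in \<open>algebra_rep\<close> runs over the support, which changes under linear
  operations. A common finite superset turns linearity into a termwise computation.\<close>

lemma algebra_rep_superset:
  fixes \<pi> :: "'a \<Rightarrow> 'i ell2 \<Rightarrow>\<^sub>L 'i ell2"
  assumes "finite F" "{g. a g \<noteq> 0} \<subseteq> F"
  shows "algebra_rep \<pi> a = (\<Sum>g\<in>F. cscale (a g) o\<^sub>L \<pi> g)"
proof -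
  have "cscale 0 = (0 :: 'i ell2 \<Rightarrow>\<^sub>L 'i ell2)"
    by (intro blinfun_eqI ell2_eqI) (simp add: cscale.rep_eq cscale_ell2.rep_eq zero_ell2.rep_eq)
  then show ?thesis
    unfolding algebra_rep_def using assms by (intro sum.mono_neutral_left) auto
qed

lemma algebra_rep_cong:
  assumes "\<And>g. a g \<noteq> 0 \<Longrightarrow> \<pi> g = \<pi>' g"
  shows "algebra_rep \<pi> a = algebra_rep \<pi>' a"
  unfolding algebra_rep_def using assms by (intro sum.cong) auto

lemma cscale_diff: "cscale (a - b) = cscale a - cscale b"
  and cscale_mult: "cscale (a * b) = cscale a o\<^sub>L cscale b"
  and cscale_of_real: "cscale (complex_of_real r) = r *\<^sub>R id_blinfun"
  by (intro blinfun_eqI ell2_eqI; simp add: cscale.rep_eq cscale_ell2.rep_eq blinfun.diff_left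
      blinfun.scaleR_left minus_ell2.rep_eq scaleR_ell2.rep_eq
      algebra_simps)+

lemma group_algebra_diff:
  assumes "a \<in> group_algebra G" "b \<in> group_algebra G"
  shows "(\<lambda>g. a g - b g) \<in> group_algebra G"
proof -
  have "{g. a g - b g \<noteq> 0} \<subseteq> {g. a g \<noteq> 0} \<union> {g. b g \<noteq> 0}" by auto
  then show ?thesis
    using assms unfolding group_algebra_def by (blast intro: finite_subset)
qed

lemma group_algebra_scale:
  "a \<in> group_algebra G \<Longrightarrow> (\<lambda>g. c * a g) \<in> group_algebra G"
  unfolding group_algebra_def by (auto intro: finite_subset[of _ "{g. a g \<noteq> 0}"])

lemma algebra_rep_diff:
  assumes "a \<in> group_algebra G" "b \<in> group_algebra G"
  shows "algebra_rep \<pi> (\<lambda>g. a g - b g) = algebra_rep \<pi> a - algebra_rep \<pi> b"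
proof -
  let ?F = "{g. a g \<noteq> 0} \<union> {g. b g \<noteq> 0}"
  have F: "finite ?F" using assms by (simp add: group_algebra_def)
  have "{g. a g - b g \<noteq> 0} \<subseteq> ?F" "{g. a g \<noteq> 0} \<subseteq> ?F" "{g. b g \<noteq> 0} \<subseteq> ?F" by auto
  note sup = this[THEN algebra_rep_superset[OF F, of _ \<pi>]]
  show ?thesis
    unfolding sup cscale_diff
    by (simp add: bounded_bilinear.diff_left[OF bounded_bilinear_blinfun_compose] sum_subtractf)
qed

lemma algebra_rep_scale:
  fixes \<pi> :: "'a \<Rightarrow> 'i ell2 \<Rightarrow>\<^sub>L 'i ell2"
  assumes "a \<in> group_algebra G"
  shows "algebra_rep \<pi> (\<lambda>g. complex_of_real r * a g) = r *\<^sub>R algebra_rep \<pi> a"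
proof -
  have "finite {g. a g \<noteq> 0}" "{g. complex_of_real r * a g \<noteq> 0} \<subseteq> {g. a g \<noteq> 0}"
    using assms by (auto simp: group_algebra_def)
  note sup = algebra_rep_superset[OF this, of \<pi>]
  have "cscale (complex_of_real r * c) o\<^sub>L A = r *\<^sub>R (cscale c o\<^sub>L A)" for c and A :: "'i ell2 \<Rightarrow>\<^sub>L 'i ell2"
    unfolding cscale_mult cscale_of_real
    by (intro blinfun_eqI) (simp add: blinfun.scaleR_left)
  then show ?thesis unfolding sup
    by (simp add: algebra_rep_def scaleR_sum_right)
qed

text \<open>The permutation representation of an arbitrary action, so that each norm estimate is
  proved once for regular, quasi-regular, diagonal and restricted representations.\<close>

definition action_rep ::
  "('a, 'b) monoid_scheme \<Rightarrow> 'i set \<Rightarrow> ('a \<Rightarrow> 'i \<Rightarrow> 'i) \<Rightarrow> 'a \<Rightarrow> 'i ell2 \<Rightarrow>\<^sub>L 'i ell2"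
  where "action_rep G S act g = perm_op S (act (inv\<^bsub>G\<^esub> g))"

lemma left_regular_eq: "left_regular G = action_rep G (carrier G) (\<otimes>\<^bsub>G\<^esub>)"
  by (intro ext) (simp add: left_regular_def action_rep_def)

lemma quasi_regular_eq: "quasi_regular G X = action_rep G (lcosets\<^bsub>G\<^esub> X) (\<lambda>g C. g <#\<^bsub>G\<^esub> C)"
  by (intro ext) (simp add: quasi_regular_def action_rep_def)

locale group_set = group G for G :: "('a, 'b) monoid_scheme" (structure) +
  fixes S :: "'i set" and act :: "'a \<Rightarrow> 'i \<Rightarrow> 'i"
  assumes act_closed: "\<And>g s. g \<in> carrier G \<Longrightarrow> s \<in> S \<Longrightarrow> act g s \<in> S"
    and act_one: "\<And>s. s \<in> S \<Longrightarrow> act \<one> s = s"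
    and act_mult: "\<And>g h s. g \<in> carrier G \<Longrightarrow> h \<in> carrier G \<Longrightarrow> s \<in> S \<Longrightarrow>
      act (g \<otimes> h) s = act g (act h s)"
begin

lemma act_inv_left: "g \<in> carrier G \<Longrightarrow> s \<in> S \<Longrightarrow> act (inv g) (act g s) = s"
  and act_inv_right: "g \<in> carrier G \<Longrightarrow> s \<in> S \<Longrightarrow> act g (act (inv g) s) = s"
  by (simp_all add: act_mult[symmetric] act_one)

lemma inj_act: "g \<in> carrier G \<Longrightarrow> inj_on (act g) S"
  by (metis act_inv_left inj_onI)

lemma action_rep_apply:
  assumes "g \<in> carrier G"
  shows "ell2_fun (blinfun_apply (action_rep G S act g) f) s =
    (if s \<in> S then ell2_fun f (act (inv g) s) else 0)"
  using assms by (simp add: action_rep_def perm_op.rep_eq perm_ell2.rep_eq inj_act)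

lemma algebra_action_rep_apply:
  assumes "a \<in> group_algebra G"
  shows "ell2_fun (blinfun_apply (algebra_rep (action_rep G S act) a) f) s =
    (if s \<in> S then \<Sum>g | a g \<noteq> 0. a g * ell2_fun f (act (inv g) s) else 0)"
  using assms unfolding algebra_rep_apply ell2_fun_sum cscale_ell2.rep_eq
  by (auto simp: group_algebra_def action_rep_apply subset_iff intro!: sum.cong)

definition stab :: "'i \<Rightarrow> 'a set"
  where "stab s = {g \<in> carrier G. act g s = s}"

lemma subgroup_stab: "s \<in> S \<Longrightarrow> subgroup (stab s) G"
  by unfold_locales (auto simp: stab_def act_mult act_one, metis act_inv_left)

end

lemma (in group) group_set_regular: "group_set G (carrier G) (\<otimes>)"
  by unfold_locales (auto simp: m_assoc)

lemma (in group) group_set_lcosets: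
  assumes "subgroup X G"
  shows "group_set G (lcosets X) (\<lambda>g C. g <# C)"
proof -
  have X: "X \<subseteq> carrier G" using assms by (rule subgroup.subset)
  show ?thesis
    by unfold_locales (auto simp: LCOSETS_def lcos_m_assoc[OF X] lcos_mult_one l_coset_subset_G[OF X] X m_assoc)
qed

section \<open>Decomposition into orbits\<close>

text \<open>Norms are tested on finite sets, which meet finitely many orbits; finite additivity and
  monotonicity thus replace a sum over all orbits.\<close>

lemma sum_infsum_disjoint_le:
  fixes h :: "'i \<Rightarrow> real"
  assumes "finite \<U>" "disjoint \<U>" "h summable_on UNIV" "\<And>x. 0 \<le> h x"
  shows "(\<Sum>U\<in>\<U>. infsum h U) \<le> infsum h UNIV"
proof -
  have sm: "h summable_on A" for A
    using assms(3) by (rule summable_on_subset_banach) simp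
  have "(\<Sum>U\<in>\<U>. infsum h U) = infsum h (\<Union>\<U>)"
    using assms(1,2)
  proof (induction \<U>)
    case (insert U \<U>)
    then have "U \<inter> \<Union>\<U> = {}" "disjoint \<U>" by (auto simp: disjoint_def)
    then show ?case using insert by (simp add: infsum_Un_disjoint sm)
  qed simp
  also have "\<dots> \<le> infsum h UNIV"
    by (intro infsum_mono2 sm) (auto simp: assms(4))
  finally show ?thesis .
qed

context group_set
begin

definition orbit :: "'i \<Rightarrow> 'i set"
  where "orbit s = (\<lambda>g. act g s) ` carrier G"

text \<open>The orbit map sending \<open>g <# stab s\<close> to \<open>act g s\<close>. Cosets are
  plain sets, so a representative is chosen; the value does not depend on it because the stabilizer
  fixes \<open>s\<close>.\<close>

definition coset_map :: "'i \<Rightarrow> 'a set \<Rightarrow> 'i"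
  where "coset_map s C = act (SOME g. g \<in> C) s"

lemma coset_map_lcoset:
  assumes "s \<in> S" "g \<in> carrier G"
  shows "coset_map s (g <# stab s) = act g s"
proof -
  have "g \<in> g <# stab s"
    using subgroup_stab[OF assms(1)] assms(2) by (rule lcos_self[rotated])
  then have mem: "(SOME h. h \<in> g <# stab s) \<in> g <# stab s" by (rule someI)
  then obtain k where k: "k \<in> stab s" "(SOME h. h \<in> g <# stab s) = g \<otimes> k"
    by (auto simp: l_coset_def)
  then show ?thesis
    using assms by (auto simp: coset_map_def stab_def act_mult)
qed

lemma lcoset_stab_eq_iff:
  assumes "s \<in> S" "g \<in> carrier G" "h \<in> carrier G"
  shows "g <# stab s = h <# stab s \<longleftrightarrow> act g s = act h s"
proof
  assume "g <# stab s = h <# stab s"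
  then show "act g s = act h s" using assms by (metis coset_map_lcoset)
next
  assume "act g s = act h s"
  then have "inv g \<otimes> h \<in> stab s"
    using assms by (simp add: stab_def act_mult act_inv_left flip: \<open>act g s = act h s\<close>)
  moreover have "h = g \<otimes> (inv g \<otimes> h)" using assms by (simp flip: m_assoc)
  ultimately have "h \<in> g <# stab s" unfolding l_coset_def by blast
  then show "g <# stab s = h <# stab s"
    using assms subgroup_stab by (intro l_repr_independence) auto
qed

lemma inj_on_coset_map:
  assumes "s \<in> S"
  shows "inj_on (coset_map s) (lcosets (stab s))"
  using assms by (auto simp: inj_on_def LCOSETS_def coset_map_lcoset lcoset_stab_eq_iff)

lemma coset_map_image:
  assumes "s \<in> S"
  shows "coset_map s ` (lcosets (stab s)) = orbit s"
  using assms by (force simp: LCOSETS_def orbit_def coset_map_lcoset image_iff)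

text \<open>The orbit map is equivariant, so pulling back along it intertwines the two
  representations, for group elements and hence for their linear combinations.\<close>

lemma pull_coset_map:
  assumes s: "s \<in> S" and a: "a \<in> group_algebra G"
  shows "pull_ell2 (lcosets (stab s)) (coset_map s) (blinfun_apply (algebra_rep (action_rep G S act) a) f) =
    blinfun_apply (algebra_rep (quasi_regular G (stab s)) a) (pull_ell2 (lcosets (stab s)) (coset_map s) f)"
proof (rule ell2_eqI)
  fix C
  interpret L: group_set G "lcosets (stab s)" "\<lambda>g C. g <#\<^bsub>G\<^esub> C"
    using subgroup_stab[OF s] by (rule group_set_lcosets)
  have inj: "inj_on (coset_map s) (lcosets (stab s))" using s by (rule inj_on_coset_map)
  have X: "stab s \<subseteq> carrier G" by (auto simp: stab_def)
  show "ell2_fun (pull_ell2 (lcosets (stab s)) (coset_map s) (blinfun_apply (algebra_rep (action_rep G S act) a) f)) C =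
    ell2_fun (blinfun_apply (algebra_rep (quasi_regular G (stab s)) a) (pull_ell2 (lcosets (stab s)) (coset_map s) f)) C"
  proof (cases "C \<in> lcosets (stab s)")
    case True
    then obtain g where g: "g \<in> carrier G" "C = g <# stab s" by (auto simp: LCOSETS_def)
    have "coset_map s (inv h <# C) = act (inv h) (coset_map s C)" if "h \<in> carrier G" for h
      using that s g by (simp add: lcos_m_assoc[OF X] coset_map_lcoset act_mult)
    moreover have "coset_map s C \<in> S" using s g by (simp add: coset_map_lcoset act_closed)
    moreover have "h \<in> carrier G" if "a h \<noteq> 0" for h using a that by (auto simp: group_algebra_def)
    ultimately show ?thesis
      using True a unfolding quasi_regular_eq
      by (auto simp: pull_ell2.rep_eq inj L.algebra_action_rep_apply algebra_action_rep_apply L.act_closed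
          intro!: sum.cong)
  next
    case False
    then show ?thesis
      using a unfolding quasi_regular_eq by (simp add: pull_ell2.rep_eq L.algebra_action_rep_apply)
  qed
qed

text \<open>The functions supported on one orbit form a subrepresentation equivalent to the
  quasi-regular one of the stabilizer, and restricting to a subrepresentation does not increase the
  norm.\<close>

lemma norm_quasi_regular_stab_le:
  assumes s: "s \<in> S" and a: "a \<in> group_algebra G"
  shows "norm (algebra_rep (quasi_regular G (stab s)) a) \<le> norm (algebra_rep (action_rep G S act) a)"
proof (rule norm_blinfun_bound)
  fix h :: "'a set ell2"
  interpret L: group_set G "lcosets (stab s)" "\<lambda>g C. g <#\<^bsub>G\<^esub> C"
    using subgroup_stab[OF s] by (rule group_set_lcosets)
  let ?L = "lcosets (stab s)" and ?\<theta> = "coset_map s"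
  have inj: "inj_on ?\<theta> ?L" using s by (rule inj_on_coset_map)
  \<comment> \<open>\<open>h\<close> is carried to the orbit along the inverse of the orbit map and
    extended by zero. Pulling \<open>f\<close> back recovers \<open>h\<close> on cosets only, which
    suffices: the operator ignores all other values.\<close>
  define f where "f = pull_ell2 (?\<theta> ` ?L) (inv_into ?L ?\<theta>) h"
  have pull: "ell2_fun (pull_ell2 ?L ?\<theta> f) C = ell2_fun h C" if "C \<in> ?L" for C
    using that inj by (auto simp: f_def pull_ell2.rep_eq inj_on_inv_into)
  have sub: "h \<in> carrier G" if "a h \<noteq> 0" for h using a that by (auto simp: group_algebra_def)
  have "blinfun_apply (algebra_rep (quasi_regular G (stab s)) a) h =
      blinfun_apply (algebra_rep (quasi_regular G (stab s)) a) (pull_ell2 ?L ?\<theta> f)"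
    using a sub unfolding quasi_regular_eq
    by (intro ell2_eqI) (auto simp: L.algebra_action_rep_apply pull L.act_closed intro!: sum.cong)
  also have "\<dots> = pull_ell2 ?L ?\<theta> (blinfun_apply (algebra_rep (action_rep G S act) a) f)"
    by (rule pull_coset_map[OF assms, symmetric])
  finally have "norm (blinfun_apply (algebra_rep (quasi_regular G (stab s)) a) h) \<le>
      norm (blinfun_apply (algebra_rep (action_rep G S act) a) f)"
    by (simp add: norm_pull_ell2_le)
  also have "\<dots> \<le> norm (algebra_rep (action_rep G S act) a) * norm f" by (rule norm_blinfun)
  also have "\<dots> \<le> norm (algebra_rep (action_rep G S act) a) * norm h"
    unfolding f_def by (intro mult_left_mono norm_pull_ell2_le) simp
  finally show "norm (blinfun_apply (algebra_rep (quasi_regular G (stab s)) a) h) \<le>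
      norm (algebra_rep (action_rep G S act) a) * norm h" .
qed simp

lemma orbit_eq:
  assumes "s \<in> S" "t \<in> S" "u \<in> orbit s" "u \<in> orbit t"
  shows "orbit s = orbit t"
proof -
  have *: "orbit (act g s) = orbit s" if "g \<in> carrier G" "s \<in> S" for g s
  proof -
    have "act h s \<in> orbit (act g s)" if "h \<in> carrier G" for h
    proof -
      have "act h s = act (h \<otimes> inv g) (act g s)"
        using that \<open>g \<in> carrier G\<close> \<open>s \<in> S\<close> by (simp add: act_mult act_inv_left act_closed)
      then show ?thesis using that \<open>g \<in> carrier G\<close> by (auto simp: orbit_def)
    qed
    then show ?thesis using that by (auto simp: orbit_def act_mult[symmetric])
  qed
  obtain g h where gh: "u = act g s" "u = act h t" "g \<in> carrier G" "h \<in> carrier G"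
    using assms(3,4) unfolding orbit_def by blast
  show ?thesis
    using *[OF gh(3) assms(1)] *[OF gh(4) assms(2)] gh(1,2) by simp
qed

lemma orbit_self: "s \<in> S \<Longrightarrow> s \<in> orbit s"
  unfolding orbit_def by (rule image_eqI[of _ _ "\<one>"]) (auto simp: act_one)

lemma norm_pull_coset_map:
  assumes "s \<in> S"
  shows "(norm (pull_ell2 (lcosets (stab s)) (coset_map s) f))\<^sup>2 = (\<Sum>\<^sub>\<infinity>x\<in>orbit s. (cmod (ell2_fun f x))\<^sup>2)"
proof -
  let ?L = "lcosets (stab s)" and ?\<theta> = "coset_map s"
  have inj: "inj_on ?\<theta> ?L" using assms by (rule inj_on_coset_map)
  have "(norm (pull_ell2 ?L ?\<theta> f))\<^sup>2 = (\<Sum>\<^sub>\<infinity>C\<in>?L. (cmod (ell2_fun f (?\<theta> C)))\<^sup>2)"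
    unfolding norm_ell2_power2 by (rule infsum_cong_neutral) (auto simp: pull_ell2.rep_eq inj)
  also have "\<dots> = (\<Sum>\<^sub>\<infinity>x\<in>?\<theta> ` ?L. (cmod (ell2_fun f x))\<^sup>2)"
    by (simp add: infsum_reindex[OF inj] o_def)
  finally show ?thesis by (simp add: coset_map_image[OF assms])
qed

text \<open>Decomposing \<open>S\<close> into orbits exhibits the representation as a direct sum of quasi-regular
  ones.\<close>

lemma norm_action_rep_le:
  assumes a: "a \<in> group_algebra G" and "0 \<le> B"
    and B: "\<And>s. s \<in> S \<Longrightarrow> norm (algebra_rep (quasi_regular G (stab s)) a) \<le> B"
  shows "norm (algebra_rep (action_rep G S act) a) \<le> B"
proof (rule norm_blinfun_bound[OF \<open>0 \<le> B\<close>])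
  fix f :: "'i ell2"
  define F where "F = blinfun_apply (algebra_rep (action_rep G S act) a) f"
  show "norm F \<le> B * norm f"
  proof (rule norm_ell2_leI)
    fix A :: "'i set" assume A: "finite A"
    let ?h = "\<lambda>x. (cmod (ell2_fun f x))\<^sup>2" and ?k = "\<lambda>x. (cmod (ell2_fun F x))\<^sup>2"
    have sm: "?k summable_on M" for M
      by (rule summable_on_subset_banach[OF ell2_fun_summable]) simp
    \<comment> \<open>Only the orbits that meet the finite test set \<open>A\<close>; for these the
      orbitwise bounds can be added up.\<close>
    define \<U> where "\<U> = orbit ` (A \<inter> S)"
    have fin: "finite \<U>" using A by (simp add: \<U>_def)
    have disj: "disjoint \<U>" using orbit_eq by (fastforce simp: \<U>_def disjoint_def)
    have "(\<Sum>x\<in>A. ?k x) = (\<Sum>x\<in>A \<inter> S. ?k x)"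
      using A a by (intro sum.mono_neutral_right) (auto simp: F_def algebra_action_rep_apply)
    also have "\<dots> = (\<Sum>U\<in>\<U>. \<Sum>x\<in>{x \<in> A \<inter> S. orbit x = U}. ?k x)"
      using A by (intro sum.group[symmetric] fin) (auto simp: \<U>_def)
    also have "\<dots> \<le> (\<Sum>U\<in>\<U>. B\<^sup>2 * infsum ?h U)"
    proof (rule sum_mono)
      fix U assume "U \<in> \<U>"
      then obtain s where s: "s \<in> S" "U = orbit s" by (auto simp: \<U>_def)
      let ?p = "pull_ell2 (lcosets (stab s)) (coset_map s)"
      have "(\<Sum>x\<in>{x \<in> A \<inter> S. orbit x = U}. ?k x) \<le> infsum ?k U"
        using A by (intro finite_sum_le_infsum sm) (auto simp: orbit_self)
      also have "\<dots> = (norm (?p F))\<^sup>2" using s by (simp add: norm_pull_coset_map)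
      also have "\<dots> = (norm (blinfun_apply (algebra_rep (quasi_regular G (stab s)) a) (?p f)))\<^sup>2"
        unfolding F_def pull_coset_map[OF s(1) a] ..
      also have "\<dots> \<le> (B * norm (?p f))\<^sup>2"
        using norm_blinfun mult_right_mono[OF B[OF s(1)] norm_ge_zero]
        by (intro power_mono) (blast intro: order_trans, simp)
      also have "\<dots> = B\<^sup>2 * infsum ?h U"
        using s by (simp add: power_mult_distrib norm_pull_coset_map)
      finally show "(\<Sum>x\<in>{x \<in> A \<inter> S. orbit x = U}. ?k x) \<le> B\<^sup>2 * infsum ?h U" .
    qed
    also have "\<dots> \<le> B\<^sup>2 * infsum ?h UNIV"
      unfolding sum_distrib_left[symmetric]
      by (intro mult_left_mono sum_infsum_disjoint_le fin disj) auto
    also have "\<dots> = (B * norm f)\<^sup>2"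
      by (simp add: power_mult_distrib norm_ell2_power2)
    finally show "(\<Sum>x\<in>A. ?k x) \<le> (B * norm f)\<^sup>2" .
  qed (use \<open>0 \<le> B\<close> in simp)
qed

end

text \<open>All stabilizers are trivial, so the lower bound from one orbit and the upper bound from
  all orbits coincide.\<close>

lemma (in group_set) norm_free_action_rep_eq_quasi:
  assumes a: "a \<in> group_algebra G" and "S \<noteq> {}"
    and free: "\<And>g s. g \<in> carrier G \<Longrightarrow> s \<in> S \<Longrightarrow> act g s = s \<Longrightarrow> g = \<one>"
  shows "norm (algebra_rep (action_rep G S act) a) = norm (algebra_rep (quasi_regular G {\<one>}) a)"
proof -
  have st: "stab s = {\<one>}" if "s \<in> S" for s
    using that free act_one by (auto simp: stab_def)
  obtain s where "s \<in> S" using \<open>S \<noteq> {}\<close> by auto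
  then show ?thesis
    using norm_quasi_regular_stab_le[OF _ a, of s]
    by (intro antisym norm_action_rep_le[OF a norm_ge_zero]) (auto simp: st)
qed

text \<open>Translation of the group on itself is free as well, so both norms equal that of the
  action on cosets of the trivial subgroup.\<close>

lemma (in group_set) norm_free_action_rep:
  assumes a: "a \<in> group_algebra G" and "S \<noteq> {}"
    and free: "\<And>g s. g \<in> carrier G \<Longrightarrow> s \<in> S \<Longrightarrow> act g s = s \<Longrightarrow> g = \<one>"
  shows "norm (algebra_rep (action_rep G S act) a) = norm (algebra_rep (left_regular G) a)"
proof -
  interpret R: group_set G "carrier G" "(\<otimes>)" by (rule group_set_regular)
  have "norm (algebra_rep (left_regular G) a) = norm (algebra_rep (quasi_regular G {\<one>}) a)"
    unfolding left_regular_eq by (rule R.norm_free_action_rep_eq_quasi[OF a]) auto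
  then show ?thesis using norm_free_action_rep_eq_quasi[OF assms] by simp
qed

section \<open>A separation theorem\<close>

definition sublinear :: "('v :: real_vector \<Rightarrow> real) \<Rightarrow> bool"
  where "sublinear q \<longleftrightarrow> (\<forall>x y. q (x + y) \<le> q x + q y) \<and> (\<forall>t x. 0 < t \<longrightarrow> q (t *\<^sub>R x) = t * q x)"

text \<open>The inequality for \<open>inverse t\<close> at the point \<open>t *\<^sub>R x\<close> is
  the reverse inequality for \<open>t\<close>.\<close>

lemma sublinearI:
  assumes "\<And>x y. q (x + y) \<le> q x + q y" and "\<And>t x. 0 < t \<Longrightarrow> q (t *\<^sub>R x) \<le> t * q x"
  shows "sublinear q"
proof -
  have "t * q x \<le> q (t *\<^sub>R x)" if "0 < t" for t x
    using assms(2)[of "inverse t" "t *\<^sub>R x"] that by (simp add: field_simps)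
  then show ?thesis unfolding sublinear_def using assms by (auto intro: antisym)
qed

lemma sublinear_add: "sublinear q \<Longrightarrow> q (x + y) \<le> q x + q y"
  and sublinear_scale_pos: "sublinear q \<Longrightarrow> 0 < t \<Longrightarrow> q (t *\<^sub>R x) = t * q x"
  by (auto simp: sublinear_def)

lemma sublinear_zero: "sublinear q \<Longrightarrow> q 0 = 0"
  using sublinear_scale_pos[of q 2 0] by simp

lemma sublinear_scale: "sublinear q \<Longrightarrow> 0 \<le> t \<Longrightarrow> q (t *\<^sub>R x) = t * q x"
  by (cases "t = 0") (auto simp: sublinear_zero sublinear_scale_pos)

lemma sublinear_neg_le: "sublinear q \<Longrightarrow> - q (- x) \<le> q x"
  using sublinear_add[of q x "- x"] by (simp add: sublinear_zero)

text \<open>Directedness gives subadditivity: a member nearly optimal at \<open>x\<close> and one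
  nearly optimal at \<open>y\<close> lie above a common member. For chains this supplies the bound
  that Zorn's lemma asks for.\<close>

lemma sublinear_cINF:
  assumes "\<C> \<noteq> {}" and sub: "\<And>q. q \<in> \<C> \<Longrightarrow> sublinear q"
    and bdd: "\<And>x. bdd_below ((\<lambda>q. q x) ` \<C>)"
    and directed: "\<And>p q. p \<in> \<C> \<Longrightarrow> q \<in> \<C> \<Longrightarrow> \<exists>r\<in>\<C>. \<forall>x. r x \<le> p x \<and> r x \<le> q x"
  shows "sublinear (\<lambda>x. INF q\<in>\<C>. q x)"
proof (rule sublinearI)
  fix x y
  have *: "(INF q\<in>\<C>. q (x + y)) \<le> p x + q y" if pq: "p \<in> \<C>" "q \<in> \<C>" for p q
  proof -
    obtain r where r: "r \<in> \<C>" "\<And>x. r x \<le> p x" "\<And>x. r x \<le> q x" using directed[OF pq] by blast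
    have "(INF q\<in>\<C>. q (x + y)) \<le> r (x + y)" using r(1) by (intro cINF_lower bdd)
    also have "\<dots> \<le> p x + q y"
      using sublinear_add[OF sub[OF r(1)], of x y] r(2)[of x] r(3)[of y] by linarith
    finally show ?thesis .
  qed
  have "(INF q\<in>\<C>. q (x + y)) - p x \<le> (INF q\<in>\<C>. q y)" if "p \<in> \<C>" for p
  proof (rule cINF_greatest[OF assms(1)])
    show "(INF q\<in>\<C>. q (x + y)) - p x \<le> q y" if "q \<in> \<C>" for q
      using *[OF \<open>p \<in> \<C>\<close> that] by linarith
  qed
  note ** = this
  have "(INF q\<in>\<C>. q (x + y)) - (INF q\<in>\<C>. q y) \<le> (INF q\<in>\<C>. q x)"
  proof (rule cINF_greatest[OF assms(1)])
    show "(INF q\<in>\<C>. q (x + y)) - (INF q\<in>\<C>. q y) \<le> p x" if "p \<in> \<C>" for p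
      using **[OF that] by linarith
  qed
  then show "(INF q\<in>\<C>. q (x + y)) \<le> (INF q\<in>\<C>. q x) + (INF q\<in>\<C>. q y)" by simp
next
  fix t :: real and x assume t: "0 < t"
  have "(INF q\<in>\<C>. q (t *\<^sub>R x)) / t \<le> q x" if "q \<in> \<C>" for q
  proof -
    have "(INF q\<in>\<C>. q (t *\<^sub>R x)) \<le> q (t *\<^sub>R x)" using that by (intro cINF_lower bdd)
    then show ?thesis using t that sub by (simp add: sublinear_scale_pos field_simps)
  qed
  then have "(INF q\<in>\<C>. q (t *\<^sub>R x)) / t \<le> (INF q\<in>\<C>. q x)"
    using assms(1) by (intro cINF_greatest) auto
  then show "(INF q\<in>\<C>. q (t *\<^sub>R x)) \<le> t * (INF q\<in>\<C>. q x)"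
    using t by (simp add: field_simps)
qed

text \<open>By Zorn's lemma there is a minimal sublinear functional below \<open>q\<close>; minimality forces it to be
  odd, hence linear.\<close>

theorem Hahn_Banach_sublinear:
  fixes q :: "'v :: real_vector \<Rightarrow> real"
  assumes "sublinear q"
  obtains \<phi> where "linear \<phi>" "\<And>x. \<phi> x \<le> q x"
proof -
  define A where "A = {p. sublinear p \<and> (\<forall>x. p x \<le> q x)}"
  \<comment> \<open>The order is reversed, so that a maximal element is a pointwise minimal
    functional.\<close>
  define r where "r = {(p, p') \<in> A \<times> A. \<forall>x. p' x \<le> p x}"
  have field: "Field r = A" by (auto simp: r_def Field_def)
  have "partial_order_on A r"
    by (auto simp: r_def partial_order_on_def preorder_on_def refl_on_def trans_def antisym_def
        fun_eq_iff intro: order_trans antisym)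
  then have po: "Partial_order r" by (simp add: field)
  have "\<exists>u\<in>Field r. \<forall>p\<in>\<C>. (p, u) \<in> r" if \<C>: "\<C> \<in> Chains r" for \<C>
  proof (cases "\<C> = {}")
    case True
    then show ?thesis using assms by (auto simp: field A_def)
  next
    case False
    have sub: "p \<in> A" if "p \<in> \<C>" for p using \<C> that by (auto simp: Chains_def r_def)
    \<comment> \<open>A sublinear functional below \<open>q\<close> stays above
      \<open>- q (- x)\<close> at \<open>x\<close>, a bound independent of the functional.\<close>
    have bdd: "bdd_below ((\<lambda>q. q x) ` \<C>)" for x
    proof (rule bdd_belowI2)
      fix p assume "p \<in> \<C>"
      then have "p \<in> A" by (rule sub)
      then have "- q (- x) \<le> - p (- x)" "- p (- x) \<le> p x" by (auto simp: A_def sublinear_neg_le)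
      then show "- q (- x) \<le> p x" by linarith
    qed
    define u where "u = (\<lambda>x. INF p\<in>\<C>. p x)"
    have "sublinear u"
      unfolding u_def using False sub bdd \<C>
      by (intro sublinear_cINF) (auto simp: A_def Chains_def r_def, blast)
    moreover have le: "u x \<le> p x" if "p \<in> \<C>" for p x
      unfolding u_def using that by (intro cINF_lower bdd)
    moreover have "u x \<le> q x" for x
      using False le sub by (auto simp: A_def) (meson ex_in_conv order_trans)
    ultimately have "u \<in> A" by (simp add: A_def)
    then show ?thesis
      unfolding field using le sub by (intro bexI[of _ u]) (auto simp: r_def)
  qed
  from Zorns_po_lemma[OF po this] obtain \<phi>
    where \<phi>: "\<phi> \<in> A" and max: "\<And>p. p \<in> A \<Longrightarrow> (\<phi>, p) \<in> r \<Longrightarrow> p = \<phi>"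
    unfolding field by blast
  have min: "p = \<phi>" if "p \<in> A" "\<And>x. p x \<le> \<phi> x" for p
    using that \<phi> by (intro max) (auto simp: r_def)
  have sub: "sublinear \<phi>" using \<phi> by (simp add: A_def)
  have neg: "\<phi> (- y) = - \<phi> y" for y
  proof -
    \<comment> \<open>A competitor for minimality: it is sublinear and below \<phi> (take t = 0),
      hence equal to \<phi>. Its value at \<open>- y\<close>, estimated with t = 1, is at most
      \<open>- \<phi> y\<close>.\<close>
    define p where "p x = (INF t\<in>{0..}. \<phi> (x + t *\<^sub>R y) - t * \<phi> y)" for x
    have lower: "- \<phi> (- x) \<le> \<phi> (x + t *\<^sub>R y) - t * \<phi> y" if "0 \<le> t" for x t
      using sublinear_add[OF sub, of "x + t *\<^sub>R y" "- x"] sublinear_scale[OF sub that, of y] by simp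
    have bdd: "bdd_below ((\<lambda>t. \<phi> (x + t *\<^sub>R y) - t * \<phi> y) ` {0..})" for x
      using lower by (intro bdd_belowI2[where m = "- \<phi> (- x)"]) auto
    have le: "p x \<le> \<phi> (x + t *\<^sub>R y) - t * \<phi> y" if "0 \<le> t" for x t
      unfolding p_def using that by (intro cINF_lower bdd) auto
    have greatest: "m \<le> p x" if "\<And>t. 0 \<le> t \<Longrightarrow> m \<le> \<phi> (x + t *\<^sub>R y) - t * \<phi> y" for m x
      unfolding p_def using that by (intro cINF_greatest) auto
    have "sublinear p"
    proof (rule sublinearI)
      fix x z
      have *: "p (x + z) \<le> (\<phi> (x + s *\<^sub>R y) - s * \<phi> y) + (\<phi> (z + t *\<^sub>R y) - t * \<phi> y)"
        if "0 \<le> s" "0 \<le> t" for s t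
        using le[of "s + t" "x + z"] sublinear_add[OF sub, of "x + s *\<^sub>R y" "z + t *\<^sub>R y"] that
        by (simp add: algebra_simps)
      have "p (x + z) - (\<phi> (x + s *\<^sub>R y) - s * \<phi> y) \<le> p z" if "0 \<le> s" for s
      proof (rule greatest)
        show "p (x + z) - (\<phi> (x + s *\<^sub>R y) - s * \<phi> y) \<le> \<phi> (z + t *\<^sub>R y) - t * \<phi> y" if "0 \<le> t" for t
          using *[OF \<open>0 \<le> s\<close> that] by linarith
      qed
      note ** = this
      have "p (x + z) - p z \<le> p x"
      proof (rule greatest)
        show "p (x + z) - p z \<le> \<phi> (x + s *\<^sub>R y) - s * \<phi> y" if "0 \<le> s" for s
          using **[OF that] by linarith
      qed
      then show "p (x + z) \<le> p x + p z" by simp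
    next
      fix s :: real and x assume s: "0 < s"
      have "p (s *\<^sub>R x) / s \<le> \<phi> (x + t *\<^sub>R y) - t * \<phi> y" if "0 \<le> t" for t
        using le[of "s * t" "s *\<^sub>R x"] sublinear_scale_pos[OF sub s, of "x + t *\<^sub>R y"] s that
        by (simp add: field_simps scaleR_add_right)
      then have "p (s *\<^sub>R x) / s \<le> p x" by (rule greatest)
      then show "p (s *\<^sub>R x) \<le> s * p x" using s by (simp add: field_simps)
    qed
    moreover have "p x \<le> \<phi> x" for x using le[of 0 x] by simp
    ultimately have "p = \<phi>"
      using \<phi> by (intro min) (auto simp: A_def intro: order_trans)
    then have "\<phi> (- y) \<le> - \<phi> y"
      using le[of 1 "- y"] by (simp add: sublinear_zero[OF sub])
    then show ?thesis using sublinear_neg_le[OF sub, of y] by linarith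
  qed
  have "linear \<phi>"
  proof (rule linearI)
    fix x y
    show "\<phi> (x + y) = \<phi> x + \<phi> y"
      using sublinear_add[OF sub, of x y] sublinear_add[OF sub, of "- x" "- y"] neg[of x] neg[of y]
        neg[of "x + y"] by simp
  next
    fix t x
    show "\<phi> (t *\<^sub>R x) = t *\<^sub>R \<phi> x"
      using sublinear_scale[OF sub, of t x] sublinear_scale[OF sub, of "- t" x] neg[of "t *\<^sub>R x"]
      by (cases "0 \<le> t") auto
  qed
  then show ?thesis using that \<phi> by (auto simp: A_def)
qed

text \<open>The auxiliary \<open>q\<close> is the largest sublinear functional below the norm that
  is at most \<open>- c\<close> on every \<open>- d\<close> with \<open>d\<close> in
  \<open>D\<close>; a linear functional below it has both required properties. The distance of
  \<open>D\<close> from 0 keeps \<open>q\<close> finite, and convexity of \<open>D\<close> makes it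
  subadditive.\<close>

lemma convex_separation_norm:
  fixes D :: "'v :: real_normed_vector set"
  assumes "convex D" "D \<noteq> {}" "\<And>d. d \<in> D \<Longrightarrow> c \<le> norm d"
  obtains \<phi> where "linear \<phi>" "\<And>x. \<bar>\<phi> x\<bar> \<le> norm x" "\<And>d. d \<in> D \<Longrightarrow> c \<le> \<phi> d"
proof -
  define q where "q x = (INF (t, d)\<in>{0..} \<times> D. norm (x + t *\<^sub>R d) - c * t)" for x
  have lower: "- norm x \<le> norm (x + t *\<^sub>R d) - c * t" if "0 \<le> t" "d \<in> D" for x t d
  proof -
    have "c * t \<le> norm (t *\<^sub>R d)"
      using assms(3)[OF that(2)] that(1) by (simp add: mult.commute[of c] mult_left_mono)
    also have "\<dots> \<le> norm (x + t *\<^sub>R d) + norm x"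
      using norm_triangle_ineq4[of "x + t *\<^sub>R d" x] by simp
    finally show ?thesis by simp
  qed
  have le: "q x \<le> norm (x + t *\<^sub>R d) - c * t" if "0 \<le> t" "d \<in> D" for x t d
    unfolding q_def
    by (rule cINF_lower2[where x = "(t, d)"])
      (use that lower in \<open>auto intro!: bdd_belowI2[where m = "- norm x"]\<close>)
  have greatest: "m \<le> q x" if "\<And>t d. 0 \<le> t \<Longrightarrow> d \<in> D \<Longrightarrow> m \<le> norm (x + t *\<^sub>R d) - c * t" for m x
    unfolding q_def using that assms(2) by (intro cINF_greatest) auto
  have "sublinear q"
  proof (rule sublinearI)
    fix x y
    have *: "q (x + y) \<le> (norm (x + s *\<^sub>R d) - c * s) + (norm (y + t *\<^sub>R e) - c * t)"
      if "0 \<le> s" "0 \<le> t" "d \<in> D" "e \<in> D" for s t d e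
    proof (cases "s + t = 0")
      case True
      then have "s = 0" "t = 0" using that by auto
      then show ?thesis using le[of 0 d "x + y"] that norm_triangle_ineq[of x y] by simp
    next
      case False
      then have st: "0 < s + t" using that by auto
      \<comment> \<open>The convex combination for which \<open>s\<close> times \<open>d\<close>
        plus \<open>t\<close> times \<open>e\<close> becomes \<open>s + t\<close> times a single
        point of \<open>D\<close>.\<close>
      define f where "f = (s / (s + t)) *\<^sub>R d + (t / (s + t)) *\<^sub>R e"
      have "f \<in> D"
        unfolding f_def using that st
        by (intro convexD[OF assms(1)]) (auto simp: add_divide_distrib[symmetric])
      moreover have "(s + t) *\<^sub>R f = s *\<^sub>R d + t *\<^sub>R e"
        using st by (simp add: f_def scaleR_add_right)
      moreover have "norm (x + s *\<^sub>R d + (y + t *\<^sub>R e)) \<le> norm (x + s *\<^sub>R d) + norm (y + t *\<^sub>R e)"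
        by (rule norm_triangle_ineq)
      ultimately show ?thesis
        using le[of "s + t" f "x + y"] st by (simp add: algebra_simps)
    qed
    have **: "q (x + y) - (norm (x + s *\<^sub>R d) - c * s) \<le> q y" if sd: "0 \<le> s" "d \<in> D" for s d
    proof (rule greatest)
      show "q (x + y) - (norm (x + s *\<^sub>R d) - c * s) \<le> norm (y + t *\<^sub>R e) - c * t"
        if "0 \<le> t" "e \<in> D" for t e
        using *[OF sd(1) that(1) sd(2) that(2)] by linarith
    qed
    have "q (x + y) - q y \<le> q x"
    proof (rule greatest)
      show "q (x + y) - q y \<le> norm (x + s *\<^sub>R d) - c * s" if "0 \<le> s" "d \<in> D" for s d
        using **[OF that] by linarith
    qed
    then show "q (x + y) \<le> q x + q y" by simp
  next
    fix s :: real and x assume s: "0 < s"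
    have "q (s *\<^sub>R x) / s \<le> q x"
    proof (rule greatest)
      fix t :: real and d assume td: "0 \<le> t" "d \<in> D"
      have "norm (s *\<^sub>R x + (s * t) *\<^sub>R d) = s * norm (x + t *\<^sub>R d)"
        using s by (metis abs_of_pos norm_scaleR scaleR_add_right scaleR_scaleR)
      then show "q (s *\<^sub>R x) / s \<le> norm (x + t *\<^sub>R d) - c * t"
        using le[of "s * t" d "s *\<^sub>R x"] td s by (simp add: field_simps)
    qed
    then show "q (s *\<^sub>R x) \<le> s * q x" using s by (simp add: field_simps)
  qed
  from Hahn_Banach_sublinear[OF this] obtain \<phi> where \<phi>: "linear \<phi>" "\<And>x. \<phi> x \<le> q x" by blast
  obtain d0 where d0: "d0 \<in> D" using assms(2) by blast
  have up: "\<phi> x \<le> norm x" for x using \<phi>(2)[of x] le[OF _ d0, of 0 x] by simp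
  have neg: "\<phi> (- x) = - \<phi> x" for x using \<phi>(1) by (rule linear_neg)
  show ?thesis
  proof (rule that[OF \<phi>(1)])
    show "\<bar>\<phi> x\<bar> \<le> norm x" for x using up[of x] up[of "- x"] neg[of x] by (simp add: abs_le_iff)
    show "c \<le> \<phi> d" if "d \<in> D" for d
      using \<phi>(2)[of "- d"] le[OF _ that, of 1 "- d"] neg[of d] by simp
  qed
qed

section \<open>Amenability and weak containment\<close>

lemma lookup_scaleR [simp]: "Poly_Mapping.lookup (r *\<^sub>R x) i = r *\<^sub>R Poly_Mapping.lookup x i"
  by (simp add: scaleR_poly_mapping_def)

lemma sum_norm_lookup_le:
  assumes "finite E"
  shows "(\<Sum>i\<in>E. norm (Poly_Mapping.lookup x i)) \<le> norm x"
proof -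
  have "(\<Sum>i\<in>E. norm (Poly_Mapping.lookup x i)) \<le> (\<Sum>i\<in>E \<union> Poly_Mapping.keys x. norm (Poly_Mapping.lookup x i))"
    using assms by (intro sum_mono2) auto
  also have "\<dots> = (\<Sum>i\<in>Poly_Mapping.keys x. norm (Poly_Mapping.lookup x i))"
    using assms by (intro sum.mono_neutral_right) (auto simp: in_keys_iff)
  finally show ?thesis by (simp add: norm_poly_mapping_def dist_poly_mapping_def)
qed

lemma norm_single: "norm (Poly_Mapping.single i (r :: real)) \<le> \<bar>r\<bar>"
  by (simp add: norm_poly_mapping_def dist_poly_mapping_def)

text \<open>Day's convexity argument: if the probability vectors moved only slightly by \<open>K\<close> were
  missing, a functional separating \<open>0\<close> from the displacements would contradict the invariance of
  the mean.\<close>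

lemma (in group) amenable_almost_invariant:
  assumes "amenable G" "finite K" "K \<subseteq> carrier G" "0 < \<delta>"
  obtains p F where "finite F" "F \<subseteq> carrier G" "\<And>x. 0 \<le> p x" "\<And>x. x \<notin> F \<Longrightarrow> p x = 0" "sum p F = (1 :: real)"
    "\<And>g E. g \<in> K \<Longrightarrow> finite E \<Longrightarrow> E \<subseteq> carrier G \<Longrightarrow> (\<Sum>y\<in>E. \<bar>p (inv g \<otimes> y) - p y\<bar>) \<le> \<delta>"
proof -
  \<comment> \<open>Finitely supported functions carry the l1 norm. The first index keeps the
    displacements of the point mass at \<open>x\<close> by the different elements of
    \<open>K\<close> in separate copies, so that one separation treats all of \<open>K\<close> at
    once.\<close>
  define L :: "'a \<Rightarrow> ('a \<times> 'a) \<Rightarrow>\<^sub>0 real"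
    where "L x = (\<Sum>g\<in>K. Poly_Mapping.single (g, g \<otimes> x) 1 - Poly_Mapping.single (g, x) 1)" for x
  define D where "D = convex hull (L ` carrier G)"
  have "\<exists>d\<in>D. norm d < \<delta>"
  proof (rule ccontr)
    assume "\<not> ?thesis"
    then have far: "\<delta> \<le> norm d" if "d \<in> D" for d using that by force
    have "convex D" "D \<noteq> {}" using one_closed by (auto simp: D_def)
    from convex_separation_norm[OF this far] obtain \<phi> where \<phi>: "linear \<phi>" "\<And>x. \<bar>\<phi> x\<bar> \<le> norm x"
      "\<And>d. d \<in> D \<Longrightarrow> \<delta> \<le> \<phi> d" by metis
    define f where "f g x = \<phi> (Poly_Mapping.single (g, x) 1)" for g x
    have f: "\<bar>f g x\<bar> \<le> 1" for g x
      unfolding f_def using \<phi>(2) norm_single[of _ 1] by (metis abs_one order_trans)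
    have bdd: "bounded (h ` carrier G)" if "\<And>x. \<bar>h x\<bar> \<le> B" for h :: "'a \<Rightarrow> real" and B
      using that by (auto simp: bounded_iff)
    obtain m :: "('a \<Rightarrow> real) \<Rightarrow> real" where m:
      "\<forall>f g. bounded (f ` carrier G) \<and> bounded (g ` carrier G) \<longrightarrow> m (\<lambda>x. f x + g x) = m f + m g"
      "\<forall>c f. bounded (f ` carrier G) \<longrightarrow> m (\<lambda>x. c * f x) = c * m f"
      "\<forall>f. bounded (f ` carrier G) \<and> (\<forall>x\<in>carrier G. 0 \<le> f x) \<longrightarrow> 0 \<le> m f"
      "m (\<lambda>_. 1) = 1"
      "\<forall>g\<in>carrier G. \<forall>f. bounded (f ` carrier G) \<longrightarrow> m (\<lambda>x. f (g \<otimes> x)) = m f"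
      using assms(1) unfolding amenable_def by (elim exE conjE) (rule that)
    note add = m(1)[rule_format, OF conjI] and scale = m(2)[rule_format]
      and pos = m(3)[rule_format, OF conjI[OF _ ballI]] and one = m(4) and inv = m(5)[rule_format]
    \<comment> \<open>A translate minus the function itself, so its mean is 0. Summed over
      \<open>K\<close> these functions give \<phi> of \<open>L x\<close>, which is at least \<delta>
      everywhere: the mean would have to be both 0 and at least \<delta>.\<close>
    define h where "h g x = f g (g \<otimes> x) + (- 1) * f g x" for g x
    have h2: "\<bar>h g x\<bar> \<le> 2" for g x
      using f[of g "g \<otimes> x"] f[of g x] unfolding h_def by linarith
    have m_h: "m (h g) = 0" if "g \<in> K" for g
    proof -
      have b: "bounded (f g ` carrier G)" "bounded ((\<lambda>x. f g (g \<otimes> x)) ` carrier G)"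
        "bounded ((\<lambda>x. (- 1) * f g x) ` carrier G)"
        by (rule bdd[of _ 1], use f in simp)+
      show ?thesis
        unfolding h_def using add[OF b(2,3)] scale[OF b(1), of "- 1"] inv[OF _ b(1), of g] that assms(3) by auto
    qed
    \<comment> \<open>The bound travels with the induction because the mean is additive only on
      bounded functions.\<close>
    have "m (\<lambda>x. \<Sum>g\<in>M. h g x) = 0 \<and> (\<forall>x. \<bar>\<Sum>g\<in>M. h g x\<bar> \<le> 2 * card M)" if "finite M" "M \<subseteq> K" for M
      using that
    proof (induction M)
      case empty
      show ?case using scale[OF bdd[of "\<lambda>_. 1" 1], of 0] by simp
    next
      case (insert g M)
      then have IH: "m (\<lambda>x. \<Sum>g\<in>M. h g x) = 0" "\<And>x. \<bar>\<Sum>g\<in>M. h g x\<bar> \<le> 2 * card M" by auto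
      have "\<bar>h g x + (\<Sum>g\<in>M. h g x)\<bar> \<le> 2 + 2 * card M" for x
        using IH(2)[of x] h2[of g x] by linarith
      then show ?case
        using insert add[OF bdd[of "h g", OF h2] bdd[of "\<lambda>x. \<Sum>g\<in>M. h g x", OF IH(2)]] IH(1) m_h[of g] by simp
    qed
    then have H: "m (\<lambda>x. \<Sum>g\<in>K. h g x) = 0" "\<And>x. \<bar>\<Sum>g\<in>K. h g x\<bar> \<le> 2 * card K"
      using assms(2) by auto
    have ge: "\<delta> \<le> (\<Sum>g\<in>K. h g x)" if "x \<in> carrier G" for x
    proof -
      have "L x \<in> D" unfolding D_def using that by (intro hull_inc) auto
      then have "\<delta> \<le> \<phi> (L x)" by (rule \<phi>(3))
      also have "\<phi> (L x) = (\<Sum>g\<in>K. h g x)"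
        by (simp add: L_def linear_sum[OF \<phi>(1)] linear_diff[OF \<phi>(1)] h_def f_def)
      finally show ?thesis .
    qed
    have "0 \<le> m (\<lambda>x. (\<Sum>g\<in>K. h g x) + (- \<delta>) * 1)"
    proof (rule pos)
      have "\<bar>(\<Sum>g\<in>K. h g x) + (- \<delta>) * 1\<bar> \<le> 2 * card K + \<delta>" for x
        using H(2)[of x] \<open>0 < \<delta>\<close> by linarith
      then show "bounded ((\<lambda>x. (\<Sum>g\<in>K. h g x) + (- \<delta>) * 1) ` carrier G)" by (rule bdd)
    qed (use ge in auto)
    also have "\<dots> = m (\<lambda>x. \<Sum>g\<in>K. h g x) + m (\<lambda>x. (- \<delta>) * 1)"
      by (rule add[OF bdd[of "\<lambda>x. \<Sum>g\<in>K. h g x", OF H(2)] bdd[of "\<lambda>_. (- \<delta>) * 1" "\<bar>\<delta>\<bar>"]]) simp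
    also have "\<dots> = - \<delta>"
      using scale[OF bdd[of "\<lambda>_. 1" 1], of "- \<delta>"] H(1) one by simp
    finally show False using \<open>0 < \<delta>\<close> by simp
  qed
  then obtain d where d: "d \<in> D" "norm d < \<delta>" by blast
  then obtain S u where Su: "finite S" "S \<subseteq> L ` carrier G" "\<And>v. v \<in> S \<Longrightarrow> 0 \<le> u v" "sum u S = 1"
    "(\<Sum>v\<in>S. u v *\<^sub>R v) = d"
    unfolding D_def convex_hull_explicit by auto
  \<comment> \<open>One preimage for each vector of the convex combination: \<open>L\<close> is a
    bijection from \<open>F\<close> onto \<open>S\<close>, and the weights become a probability
    vector on the group.\<close>
  define F where "F = inv_into (carrier G) L ` S"
  have F: "finite F" "F \<subseteq> carrier G"
    using Su(1,2) by (auto simp: F_def inv_into_into)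
  have bij: "bij_betw L F S"
    unfolding F_def using Su(2) by (intro bij_betw_byWitness[where f' = "inv_into (carrier G) L"])
      (auto simp: f_inv_into_f subset_iff)
  define p where "p x = (if x \<in> F then u (L x) else 0)" for x
  have sumF: "(\<Sum>x\<in>F. p x *\<^sub>R L x) = d" "sum p F = 1"
    using sum.reindex_bij_betw[OF bij, of "\<lambda>v. u v *\<^sub>R v"] sum.reindex_bij_betw[OF bij, of u] Su(4,5)
    by (simp_all add: p_def)
  show ?thesis
  proof (rule that[OF F _ _ sumF(2)])
    show "0 \<le> p x" for x using Su(3) bij by (auto simp: p_def bij_betw_def)
    show "p x = 0" if "x \<notin> F" for x using that by (simp add: p_def)
    fix g E assume g: "g \<in> K" and E: "finite E" "E \<subseteq> carrier G"
    have gG: "g \<in> carrier G" using g assms(3) by auto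
    have "Poly_Mapping.lookup d (g, y) = p (inv g \<otimes> y) - p y" if y: "y \<in> carrier G" for y
    proof -
      have "Poly_Mapping.lookup (L x) (g, y) = (if x = inv g \<otimes> y then 1 else 0) - (if x = y then 1 else 0)"
        if "x \<in> F" for x
      proof -
        have "Poly_Mapping.lookup (L x) (g, y) =
            (\<Sum>k\<in>K. if k = g then (if g \<otimes> x = y then 1 else 0) - (if x = y then 1 else 0) else 0)"
          unfolding L_def lookup_sum
          by (intro sum.cong) (auto simp: lookup_minus lookup_single when_def)
        also have "\<dots> = (if g \<otimes> x = y then 1 else 0) - (if x = y then 1 else 0)"
          using g assms(2) by simp
        also have "g \<otimes> x = y \<longleftrightarrow> x = inv g \<otimes> y"
          using that F(2) gG y by (metis inv_solve_left subsetD)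
        finally show ?thesis .
      qed
      then have "Poly_Mapping.lookup d (g, y) =
          (\<Sum>x\<in>F. (if x = inv g \<otimes> y then p x else 0) - (if x = y then p x else 0))"
        unfolding sumF(1)[symmetric] lookup_sum by (intro sum.cong) auto
      also have "\<dots> = p (inv g \<otimes> y) - p y"
        using F(1) by (simp add: sum_subtractf p_def)
      finally show ?thesis .
    qed
    then have "(\<Sum>y\<in>E. \<bar>p (inv g \<otimes> y) - p y\<bar>) = (\<Sum>y\<in>E. norm (Poly_Mapping.lookup d (g, y)))"
      using E(2) by (intro sum.cong) auto
    also have "\<dots> = (\<Sum>i\<in>Pair g ` E. norm (Poly_Mapping.lookup d i))"
      by (subst sum.reindex) (auto simp: inj_on_def)
    also have "\<dots> \<le> norm d" using E by (intro sum_norm_lookup_le) auto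
    finally show "(\<Sum>y\<in>E. \<bar>p (inv g \<otimes> y) - p y\<bar>) \<le> \<delta>" using d(2) by simp
  qed
qed

section \<open>Tensor products and almost invariant vectors\<close>

lift_definition tensor :: "'i ell2 \<Rightarrow> 'j ell2 \<Rightarrow> ('i \<times> 'j) ell2" is "\<lambda>f g (x, y). f x * g y"
proof -
  fix f :: "'i \<Rightarrow> complex" and g :: "'j \<Rightarrow> complex"
  assume f: "(\<lambda>x. (cmod (f x))\<^sup>2) summable_on UNIV" and g: "(\<lambda>x. (cmod (g x))\<^sup>2) summable_on UNIV"
  have "(\<lambda>z. norm (case z of (x, y) \<Rightarrow> (cmod (f x))\<^sup>2 * (cmod (g y))\<^sup>2)) summable_on UNIV \<times> UNIV"
    by (rule Infinite_Sum.abs_summable_on_Sigma_iff[THEN iffD2], intro conjI ballI)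
      (use f g in \<open>simp_all add: infsum_cmult_right' infsum_nonneg summable_on_cmult_right summable_on_cmult_left\<close>)
  then show "(\<lambda>x. (cmod (case x of (x, y) \<Rightarrow> f x * g y))\<^sup>2) summable_on UNIV"
    by (simp add: case_prod_unfold norm_mult power_mult_distrib)
qed

lemma norm_tensor: "norm (tensor f g) = norm f * norm g"
proof -
  let ?f = "\<lambda>x. (cmod (ell2_fun f x))\<^sup>2" and ?g = "\<lambda>x. (cmod (ell2_fun g x))\<^sup>2"
  have eq: "(\<lambda>z. (cmod (ell2_fun (tensor f g) z))\<^sup>2) = (\<lambda>(x, y). ?f x * ?g y)"
    by (auto simp: tensor.rep_eq norm_mult power_mult_distrib)
  have "(norm (tensor f g))\<^sup>2 = infsum (\<lambda>(x, y). ?f x * ?g y) (UNIV \<times> UNIV)"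
    unfolding norm_ell2_power2 eq by simp
  also have "\<dots> = (\<Sum>\<^sub>\<infinity>x. \<Sum>\<^sub>\<infinity>y. ?f x * ?g y)"
    using ell2_fun_summable[of "tensor f g"] unfolding eq by (subst infsum_Sigma'_banach) auto
  also have "\<dots> = (norm f * norm g)\<^sup>2"
    by (simp add: infsum_cmult_right' infsum_cmult_left' norm_ell2_power2 power_mult_distrib)
  finally show ?thesis by simp
qed

lemma norm_sum_cscale_le:
  assumes "\<And>g. g \<in> I \<Longrightarrow> norm (v g) \<le> B"
  shows "norm (\<Sum>g\<in>I. cscale_ell2 (c g) (v g)) \<le> (\<Sum>g\<in>I. cmod (c g)) * B"
proof -
  have "norm (\<Sum>g\<in>I. cscale_ell2 (c g) (v g)) \<le> (\<Sum>g\<in>I. cmod (c g) * B)"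
    by (rule sum_norm_le) (auto simp: norm_cscale_ell2 intro: mult_left_mono assms)
  then show ?thesis by (simp add: sum_distrib_right)
qed

text \<open>The commutative Powers-Stormer inequality: it turns l1-closeness of probability vectors
  into l2-closeness of their square roots.\<close>

lemma sqrt_diff_power2_le:
  assumes "0 \<le> x" "0 \<le> y"
  shows "(sqrt x - sqrt y)\<^sup>2 \<le> \<bar>x - y\<bar>"
proof -
  have "\<bar>sqrt x - sqrt y\<bar> \<le> sqrt x + sqrt y" using assms by (auto simp: abs_le_iff)
  then have "\<bar>sqrt x - sqrt y\<bar> * \<bar>sqrt x - sqrt y\<bar> \<le> \<bar>sqrt x - sqrt y\<bar> * (sqrt x + sqrt y)"
    by (intro mult_left_mono) auto
  also have "\<dots> = \<bar>(sqrt x - sqrt y) * (sqrt x + sqrt y)\<bar>"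
    using assms by (simp add: abs_mult)
  also have "(sqrt x - sqrt y) * (sqrt x + sqrt y) = x - y"
    using assms by (simp add: algebra_simps)
  finally show ?thesis by (simp add: power2_eq_square)
qed

text \<open>The vector is the square root of an almost invariant probability vector; tolerance
  \<open>\<delta>\<^sup>2\<close> in l1 becomes \<delta> in l2.\<close>

lemma (in group) amenable_almost_invariant_vector:
  assumes "amenable G" "finite K" "K \<subseteq> carrier G" "0 < \<delta>"
  obtains \<eta> where "norm \<eta> = 1"
    "\<And>g. g \<in> K \<Longrightarrow> norm (blinfun_apply (left_regular G g) \<eta> - \<eta>) \<le> \<delta>"
proof -
  obtain p F where p: "finite F" "F \<subseteq> carrier G" "\<And>x. 0 \<le> p x" "\<And>x. x \<notin> F \<Longrightarrow> p x = 0" "sum p F = (1 :: real)"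
    "\<And>g E. g \<in> K \<Longrightarrow> finite E \<Longrightarrow> E \<subseteq> carrier G \<Longrightarrow> (\<Sum>y\<in>E. \<bar>p (inv g \<otimes> y) - p y\<bar>) \<le> \<delta>\<^sup>2"
    by (rule amenable_almost_invariant[OF assms(1-3) zero_less_power[OF assms(4), of 2]]) (rule that; assumption)
  interpret R: group_set G "carrier G" "(\<otimes>)" by (rule group_set_regular)
  define \<eta> where "\<eta> = Abs_ell2 (\<lambda>x. complex_of_real (sqrt (p x)))"
  have \<eta>: "ell2_fun \<eta> = (\<lambda>x. complex_of_real (sqrt (p x)))"
    unfolding \<eta>_def
  proof (rule ell2_fun_Abs[of _ 1])
    fix A :: "'a set" assume A: "finite A"
    have "(\<Sum>x\<in>A. (cmod (complex_of_real (sqrt (p x))))\<^sup>2) = sum p A" using p(3) by simp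
    also have "\<dots> \<le> sum p (A \<union> F)" using A p(1,3) by (intro sum_mono2) auto
    also have "\<dots> = sum p F" using A p(1,4) by (intro sum.mono_neutral_right) auto
    finally show "(\<Sum>x\<in>A. (cmod (complex_of_real (sqrt (p x))))\<^sup>2) \<le> 1" using p(5) by simp
  qed
  show ?thesis
  proof
    have "(norm \<eta>)\<^sup>2 = infsum p F"
      unfolding norm_ell2_power2 \<eta> using p(3,4) by (intro infsum_cong_neutral) auto
    then show "norm \<eta> = 1" using p(1,5) norm_ge_zero[of \<eta>] by (auto simp: power2_eq_1_iff)
    fix g assume g: "g \<in> K"
    show "norm (blinfun_apply (left_regular G g) \<eta> - \<eta>) \<le> \<delta>"
    proof (rule norm_ell2_leI)
      fix A :: "'a set" assume A: "finite A"
      have val: "ell2_fun (blinfun_apply (left_regular G g) \<eta> - \<eta>) x =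
          (if x \<in> carrier G then complex_of_real (sqrt (p (inv g \<otimes> x)) - sqrt (p x)) else 0)" for x
        using subsetD[OF assms(3) g] p(2) p(4)[of x]
        by (auto simp: left_regular_eq minus_ell2.rep_eq R.action_rep_apply \<eta>)
      have "(\<Sum>x\<in>A. (cmod (ell2_fun (blinfun_apply (left_regular G g) \<eta> - \<eta>) x))\<^sup>2) =
          (\<Sum>x\<in>A \<inter> carrier G. (sqrt (p (inv g \<otimes> x)) - sqrt (p x))\<^sup>2)"
        unfolding val using A by (intro sum.mono_neutral_cong_right) (auto simp flip: of_real_diff)
      also have "\<dots> \<le> (\<Sum>x\<in>A \<inter> carrier G. \<bar>p (inv g \<otimes> x) - p x\<bar>)"
        by (intro sum_mono sqrt_diff_power2_le p)
      also have "\<dots> \<le> \<delta>\<^sup>2" using A by (intro p g) auto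
      finally show "(\<Sum>x\<in>A. (cmod (ell2_fun (blinfun_apply (left_regular G g) \<eta> - \<eta>) x))\<^sup>2) \<le> \<delta>\<^sup>2" .
    qed (use assms(4) in simp)
  qed
qed

text \<open>The diagonal action on \<open>S \<times> G\<close> is free, so its representation has the norms of the regular
  one (Fell absorption); tensoring with an almost invariant vector recovers the action on \<open>S\<close>.\<close>

theorem (in group_set) norm_action_rep_le_left_regular:
  assumes "amenable G" and a: "a \<in> group_algebra G"
  shows "norm (algebra_rep (action_rep G S act) a) \<le> norm (algebra_rep (left_regular G) a)"
proof (cases "S = {}")
  case True
  then have "algebra_rep (action_rep G S act) a = 0"
    by (intro blinfun_eqI ell2_eqI, subst algebra_action_rep_apply[OF a]) (simp add: zero_ell2.rep_eq)
  then show ?thesis by simp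
next
  case False
  let ?act = "\<lambda>g (s, x). (act g s, g \<otimes> x)" and ?C = "norm (algebra_rep (left_regular G) a)"
  interpret R: group_set G "carrier G" "(\<otimes>)" by (rule group_set_regular)
  interpret W: group_set G "S \<times> carrier G" ?act
    by unfold_locales (auto simp: act_closed act_one act_mult m_assoc)
  have C: "norm (algebra_rep (action_rep G (S \<times> carrier G) ?act) a) = ?C"
    using False by (intro W.norm_free_action_rep a) (auto dest: r_cancel_one[THEN iffD1, rotated -1])
  define M where "M = (\<Sum>g | a g \<noteq> 0. cmod (a g))"
  have M: "0 \<le> M" unfolding M_def by (intro sum_nonneg) auto
  have sub: "g \<in> carrier G" if "a g \<noteq> 0" for g using a that by (auto simp: group_algebra_def)
  have rep_le: "norm (blinfun_apply (action_rep G S act g) f) \<le> norm f" for g f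
    by (simp add: action_rep_def perm_op.rep_eq norm_perm_ell2_le)
  show ?thesis
  proof (rule norm_blinfun_bound)
    fix f
    let ?\<rho> = "\<lambda>g. blinfun_apply (action_rep G S act g)"
    show "norm (blinfun_apply (algebra_rep (action_rep G S act) a) f) \<le> ?C * norm f"
    proof (rule field_le_epsilon)
      fix e :: real assume e: "0 < e"
      \<comment> \<open>The error will be at most M times \<open>norm f\<close> times \<delta>; the
        summands 1 keep the divisor positive when \<open>a\<close> or \<open>f\<close>
        vanishes.\<close>
      define m where "m = (M + 1) * (norm f + 1)"
      have pos: "0 < m" unfolding m_def using M by (intro mult_pos_pos) (auto simp: add_nonneg_pos)
      define \<delta> where "\<delta> = e / m"
      have \<delta>: "0 < \<delta>" unfolding \<delta>_def using e pos by simp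
      obtain \<eta> where \<eta>: "norm \<eta> = 1"
        "\<And>g. a g \<noteq> 0 \<Longrightarrow> norm (blinfun_apply (left_regular G g) \<eta> - \<eta>) \<le> \<delta>"
        using amenable_almost_invariant_vector[OF assms(1) _ _ \<delta>, of "{g. a g \<noteq> 0}"] a
        by (auto simp: group_algebra_def)
      \<comment> \<open>The diagonal operator moves both tensor factors. \<open>?err\<close> is the
        price of leaving \<eta> fixed in each term.\<close>
      let ?err = "\<Sum>g | a g \<noteq> 0. cscale_ell2 (a g) (tensor (?\<rho> g f) (blinfun_apply (left_regular G g) \<eta> - \<eta>))"
      have "tensor (blinfun_apply (algebra_rep (action_rep G S act) a) f) \<eta> =
          blinfun_apply (algebra_rep (action_rep G (S \<times> carrier G) ?act) a) (tensor f \<eta>) - ?err"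
      proof (rule ell2_eqI)
        fix z :: "'i \<times> 'a"
        obtain s x where z: "z = (s, x)" by (cases z)
        show "ell2_fun (tensor (blinfun_apply (algebra_rep (action_rep G S act) a) f) \<eta>) z =
            ell2_fun (blinfun_apply (algebra_rep (action_rep G (S \<times> carrier G) ?act) a) (tensor f \<eta>) - ?err) z"
          unfolding z algebra_rep_apply tensor.rep_eq minus_ell2.rep_eq ell2_fun_sum cscale_ell2.rep_eq
            sum_distrib_right sum_subtractf[symmetric] prod.case
          by (intro sum.cong)
            (auto simp: sub W.action_rep_apply action_rep_apply R.action_rep_apply left_regular_eq
              tensor.rep_eq algebra_simps)
      qed
      then have "norm (blinfun_apply (algebra_rep (action_rep G S act) a) f) =
          norm (blinfun_apply (algebra_rep (action_rep G (S \<times> carrier G) ?act) a) (tensor f \<eta>) - ?err)"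
        by (metis norm_tensor \<eta>(1) mult.right_neutral)
      also have "\<dots> \<le> norm (blinfun_apply (algebra_rep (action_rep G (S \<times> carrier G) ?act) a) (tensor f \<eta>)) + norm ?err"
        by (rule norm_triangle_ineq4)
      also have "\<dots> \<le> ?C * norm f + M * (norm f * \<delta>)"
      proof (rule add_mono)
        show "norm (blinfun_apply (algebra_rep (action_rep G (S \<times> carrier G) ?act) a) (tensor f \<eta>)) \<le> ?C * norm f"
          using norm_blinfun[of "algebra_rep (action_rep G (S \<times> carrier G) ?act) a" "tensor f \<eta>"]
          by (simp add: C norm_tensor \<eta>(1))
        show "norm ?err \<le> M * (norm f * \<delta>)"
          unfolding M_def
          by (intro norm_sum_cscale_le) (auto simp: norm_tensor intro!: mult_mono rep_le \<eta>(2))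
      qed
      also have "M * (norm f * \<delta>) \<le> m * \<delta>"
        unfolding m_def using M \<delta> by (simp add: mult.assoc[symmetric] mult_mono)
      also have "\<dots> = e" using pos by (simp add: \<delta>_def)
      finally show "norm (blinfun_apply (algebra_rep (action_rep G S act) a) f) \<le> ?C * norm f + e" by simp
    qed
  qed simp
qed

section \<open>The group algebra as a *-algebra\<close>

text \<open>Indexing by pairs from the two supports lets a product of two finite sums be regrouped
  by the fibres of multiplication.\<close>

definition convolution ::
  "('a, 'b) monoid_scheme \<Rightarrow> ('a \<Rightarrow> complex) \<Rightarrow> ('a \<Rightarrow> complex) \<Rightarrow> 'a \<Rightarrow> complex"
  where "convolution G a b k =
    (\<Sum>(g, h)\<in>{(g, h). a g \<noteq> 0 \<and> b h \<noteq> 0 \<and> g \<otimes>\<^bsub>G\<^esub> h = k}. a g * b h)"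

definition involution :: "('a, 'b) monoid_scheme \<Rightarrow> ('a \<Rightarrow> complex) \<Rightarrow> 'a \<Rightarrow> complex"
  where "involution G a g = (if g \<in> carrier G then cnj (a (inv\<^bsub>G\<^esub> g)) else 0)"

lemma convolution_support:
  "{k. convolution G a b k \<noteq> 0} \<subseteq> (\<lambda>(g, h). g \<otimes>\<^bsub>G\<^esub> h) ` ({g. a g \<noteq> 0} \<times> {h. b h \<noteq> 0})"
proof (rule subsetI, rule ccontr)
  fix k assume k: "k \<in> {k. convolution G a b k \<noteq> 0}"
    and "k \<notin> (\<lambda>(g, h). g \<otimes>\<^bsub>G\<^esub> h) ` ({g. a g \<noteq> 0} \<times> {h. b h \<noteq> 0})"
  then have empty: "{(g, h). a g \<noteq> 0 \<and> b h \<noteq> 0 \<and> g \<otimes>\<^bsub>G\<^esub> h = k} = {}" by auto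
  show False using k unfolding convolution_def mem_Collect_eq empty by simp
qed

lemma group_algebra_convolution:
  assumes "group G" "a \<in> group_algebra G" "b \<in> group_algebra G"
  shows "convolution G a b \<in> group_algebra G"
proof -
  interpret group G by fact
  let ?K = "(\<lambda>(g, h). g \<otimes>\<^bsub>G\<^esub> h) ` ({g. a g \<noteq> 0} \<times> {h. b h \<noteq> 0})"
  have "finite ?K" "?K \<subseteq> carrier G"
    using assms(2,3) by (auto simp: group_algebra_def)
  then show ?thesis
    using convolution_support[of G a b] unfolding group_algebra_def by (blast intro: finite_subset)
qed

lemma group_algebra_involution:
  assumes "group G" "a \<in> group_algebra G"
  shows "involution G a \<in> group_algebra G"
proof -
  interpret group G by fact
  have "{g. involution G a g \<noteq> 0} \<subseteq> (\<lambda>g. inv\<^bsub>G\<^esub> g) ` {g. a g \<noteq> 0}"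
  proof
    fix g assume "g \<in> {g. involution G a g \<noteq> 0}"
    then show "g \<in> (\<lambda>g. inv\<^bsub>G\<^esub> g) ` {g. a g \<noteq> 0}"
      by (intro image_eqI[of _ _ "inv\<^bsub>G\<^esub> g"]) (auto simp: involution_def split: if_splits)
  qed
  moreover have "{g. involution G a g \<noteq> 0} \<subseteq> carrier G"
    by (auto simp: involution_def)
  ultimately show ?thesis
    using assms(2) by (auto simp: group_algebra_def intro: finite_subset)
qed

lemma cscale_ell2_zero [simp]: "cscale_ell2 0 f = 0" "cscale_ell2 c 0 = 0"
  and cscale_ell2_add_right: "cscale_ell2 c (f + g) = cscale_ell2 c f + cscale_ell2 c g"
  and cscale_ell2_add_left: "cscale_ell2 (c + d) f = cscale_ell2 c f + cscale_ell2 d f"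
  and cscale_ell2_mult: "cscale_ell2 (c * d) f = cscale_ell2 c (cscale_ell2 d f)"
  by (intro ell2_eqI; simp add: cscale_ell2.rep_eq plus_ell2.rep_eq zero_ell2.rep_eq algebra_simps)+

lemma cscale_ell2_sum_right: "cscale_ell2 c (\<Sum>i\<in>I. f i) = (\<Sum>i\<in>I. cscale_ell2 c (f i))"
  by (induction I rule: infinite_finite_induct) (simp_all add: cscale_ell2_add_right)

lemma cscale_ell2_sum_left: "cscale_ell2 (\<Sum>i\<in>I. c i) f = (\<Sum>i\<in>I. cscale_ell2 (c i) f)"
  by (induction I rule: infinite_finite_induct) (simp_all add: cscale_ell2_add_left)

text \<open>Although the inner product is only the real part of the complex one, multiplication by a
  complex number still has the conjugate as its adjoint. Real inner product spaces therefore suffice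
  for the star operation.\<close>

lemma inner_cscale_ell2: "inner (cscale_ell2 c f) g = inner f (cscale_ell2 (cnj c) g)"
  unfolding inner_ell2_def cscale_ell2.rep_eq
  by (intro infsum_cong) (simp add: inner_complex_def algebra_simps)

context group_set
begin

lemma action_rep_cscale:
  "blinfun_apply (action_rep G S act g) (cscale_ell2 c f) = cscale_ell2 c (blinfun_apply (action_rep G S act g) f)"
  by (intro ell2_eqI) (simp add: action_rep_def perm_op.rep_eq perm_ell2.rep_eq cscale_ell2.rep_eq)

lemma action_rep_mult:
  assumes "g \<in> carrier G" "h \<in> carrier G"
  shows "blinfun_apply (action_rep G S act (g \<otimes> h)) f =
    blinfun_apply (action_rep G S act g) (blinfun_apply (action_rep G S act h) f)"
  using assms by (intro ell2_eqI) (simp add: action_rep_apply inv_mult_group act_mult act_closed)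

lemma inner_action_rep:
  assumes g: "g \<in> carrier G"
  shows "inner (blinfun_apply (action_rep G S act g) f) h = inner f (blinfun_apply (action_rep G S act (inv g)) h)"
proof -
  have bij: "bij_betw (act g) S S"
    using g by (intro bij_betw_byWitness[where f' = "act (inv g)"])
      (auto simp: act_inv_left act_inv_right act_closed)
  have "inner (blinfun_apply (action_rep G S act g) f) h =
      (\<Sum>\<^sub>\<infinity>s\<in>S. inner (ell2_fun f (act (inv g) s)) (ell2_fun h s))"
    unfolding inner_ell2_def using g by (intro infsum_cong_neutral) (auto simp: action_rep_apply)
  also have "\<dots> = (\<Sum>\<^sub>\<infinity>s\<in>S. inner (ell2_fun f (act (inv g) (act g s))) (ell2_fun h (act g s)))"
    by (rule infsum_reindex_bij_betw[OF bij, symmetric])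
  also have "\<dots> = (\<Sum>\<^sub>\<infinity>s\<in>S. inner (ell2_fun f s) (ell2_fun h (act g s)))"
    using g by (intro infsum_cong) (simp add: act_inv_left)
  also have "\<dots> = inner f (blinfun_apply (action_rep G S act (inv g)) h)"
    unfolding inner_ell2_def using g by (intro infsum_cong_neutral) (auto simp: action_rep_apply)
  finally show ?thesis .
qed

lemma algebra_rep_convolution:
  assumes a: "a \<in> group_algebra G" and b: "b \<in> group_algebra G"
  shows "blinfun_apply (algebra_rep (action_rep G S act) (convolution G a b)) f =
    blinfun_apply (algebra_rep (action_rep G S act) a) (blinfun_apply (algebra_rep (action_rep G S act) b) f)"
proof -
  let ?\<rho> = "\<lambda>g. blinfun_apply (action_rep G S act g)"
  let ?P = "{g. a g \<noteq> 0} \<times> {h. b h \<noteq> 0}" and ?K = "(\<lambda>(g, h). g \<otimes> h) ` ({g. a g \<noteq> 0} \<times> {h. b h \<noteq> 0})"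
  have fin: "finite ?P" "finite ?K" using a b by (auto simp: group_algebra_def)
  have sub: "g \<in> carrier G" if "a g \<noteq> 0 \<or> b g \<noteq> 0" for g
    using a b that by (auto simp: group_algebra_def)
  have conv: "convolution G a b k = (\<Sum>(g, h)\<in>{x \<in> ?P. (\<lambda>(g, h). g \<otimes> h) x = k}. a g * b h)" for k
    unfolding convolution_def by (intro sum.cong) auto
  have "blinfun_apply (algebra_rep (action_rep G S act) (convolution G a b)) f =
      (\<Sum>k\<in>?K. cscale_ell2 (convolution G a b k) (?\<rho> k f))"
    unfolding algebra_rep_apply using fin(2) convolution_support by (rule sum.mono_neutral_left) auto
  also have "\<dots> = (\<Sum>k\<in>?K. \<Sum>x\<in>{x \<in> ?P. (\<lambda>(g, h). g \<otimes> h) x = k}.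
      case x of (g, h) \<Rightarrow> cscale_ell2 (a g * b h) (?\<rho> (g \<otimes> h) f))"
    unfolding conv cscale_ell2_sum_left by (intro sum.cong refl) auto
  also have "\<dots> = (\<Sum>(g, h)\<in>?P. cscale_ell2 (a g * b h) (?\<rho> (g \<otimes> h) f))"
    by (rule sum.group) (use fin in auto)
  also have "\<dots> = (\<Sum>(g, h)\<in>?P. cscale_ell2 (a g) (?\<rho> g (cscale_ell2 (b h) (?\<rho> h f))))"
    using sub by (intro sum.cong) (auto simp: action_rep_mult action_rep_cscale cscale_ell2_mult)
  also have "\<dots> = (\<Sum>g | a g \<noteq> 0. \<Sum>h | b h \<noteq> 0. cscale_ell2 (a g) (?\<rho> g (cscale_ell2 (b h) (?\<rho> h f))))"
    by (rule sum.cartesian_product[symmetric])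
  also have "\<dots> = blinfun_apply (algebra_rep (action_rep G S act) a) (blinfun_apply (algebra_rep (action_rep G S act) b) f)"
    unfolding algebra_rep_apply by (simp add: blinfun.sum_right cscale_ell2_sum_right)
  finally show ?thesis .
qed

text \<open>Group elements act unitarily and scalars are conjugated. Adjoints are thus obtained
  explicitly from \<open>involution\<close>, without a representation theorem for
  functionals.\<close>

lemma inner_algebra_rep:
  assumes a: "a \<in> group_algebra G"
  shows "inner (blinfun_apply (algebra_rep (action_rep G S act) a) f) h =
    inner f (blinfun_apply (algebra_rep (action_rep G S act) (involution G a)) h)"
proof -
  let ?\<rho> = "\<lambda>g. blinfun_apply (action_rep G S act g)"
  have sub: "g \<in> carrier G" if "a g \<noteq> 0" for g using a that by (auto simp: group_algebra_def)
  have bij: "bij_betw (\<lambda>g. inv g) {g. a g \<noteq> 0} {g. involution G a g \<noteq> 0}"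
    by (rule bij_betw_byWitness[where f' = "\<lambda>g. inv g"])
      (auto simp: involution_def sub split: if_splits)
  have "inner (blinfun_apply (algebra_rep (action_rep G S act) a) f) h =
      (\<Sum>g | a g \<noteq> 0. inner f (cscale_ell2 (involution G a (inv g)) (?\<rho> (inv g) h)))"
    unfolding algebra_rep_apply inner_sum_left
    by (intro sum.cong) (auto simp: inner_cscale_ell2 inner_action_rep sub involution_def action_rep_cscale)
  also have "\<dots> = (\<Sum>g | involution G a g \<noteq> 0. inner f (cscale_ell2 (involution G a g) (?\<rho> g h)))"
    by (rule sum.reindex_bij_betw[OF bij])
  also have "\<dots> = inner f (blinfun_apply (algebra_rep (action_rep G S act) (involution G a)) h)"
    unfolding algebra_rep_apply inner_sum_right ..
  finally show ?thesis .
qed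

end

section \<open>Powers of a positive contraction\<close>

locale adjoint_pair =
  fixes T T' :: "'h :: real_inner \<Rightarrow>\<^sub>L 'h" and R :: real
  assumes adjoint: "inner (blinfun_apply T x) y = inner x (blinfun_apply T' y)"
    and R: "norm T \<le> R" "0 < R"
begin

text \<open>The operator 1 - T' T / R^2, which lies between 0 and 1 since T' is the adjoint of T and
  the norm of T is at most R.\<close>

definition D :: "'h \<Rightarrow> 'h"
  where "D x = x - (1 / R\<^sup>2) *\<^sub>R blinfun_apply T' (blinfun_apply T x)"

lemma norm_T: "norm (blinfun_apply T x) \<le> R * norm x"
  using norm_blinfun[of T x] R(1) by (meson mult_right_mono norm_ge_zero order_trans)

lemma adjoint': "inner (blinfun_apply T' x) y = inner x (blinfun_apply T y)"
  using adjoint[of y x] by (simp add: inner_commute)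

text \<open>The square of the norm of T' y is the inner product of y with T T' y; one factor is then
  cancelled. The bound \<open>B\<close> is left free because both \<open>R\<close> and the smaller
  \<epsilon> are inserted later.\<close>

lemma norm_T'_le:
  assumes "\<And>x. norm (blinfun_apply T x) \<le> B * norm x"
  shows "norm (blinfun_apply T' y) \<le> B * norm y"
proof (cases "blinfun_apply T' y = 0")
  case True
  have "0 \<le> B * norm y" using assms[of y] norm_ge_zero order_trans by blast
  then show ?thesis using True by simp
next
  case False
  have "norm (blinfun_apply T' y) * norm (blinfun_apply T' y) = inner y (blinfun_apply T (blinfun_apply T' y))"
    by (simp add: power2_norm_eq_inner adjoint' flip: power2_eq_square)
  also have "\<dots> \<le> norm y * norm (blinfun_apply T (blinfun_apply T' y))" by (rule norm_cauchy_schwarz)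
  also have "\<dots> \<le> norm y * (B * norm (blinfun_apply T' y))"
    by (intro mult_left_mono assms) simp
  finally show ?thesis using False by (simp add: algebra_simps)
qed

lemma norm_diff_power2:
  "(norm (x - r *\<^sub>R v))\<^sup>2 = (norm x)\<^sup>2 - 2 * (r * inner x v) + r\<^sup>2 * (norm v)\<^sup>2"
  for x v :: "'h"
  unfolding power2_norm_eq_inner inner_diff_left inner_diff_right inner_scaleR_left inner_scaleR_right
    inner_commute[of v x] by algebra

lemma D_diff: "D (x - y) = D x - D y"
  by (simp add: D_def blinfun.diff_right algebra_simps)

lemma D_symmetric: "inner (D x) y = inner x (D y)"
  by (simp add: D_def inner_diff adjoint adjoint')

lemma inner_D: "inner (D x) x = (norm x)\<^sup>2 - (norm (blinfun_apply T x))\<^sup>2 / R\<^sup>2"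
  by (simp add: D_def inner_diff adjoint' power2_norm_eq_inner)

lemma D_nonneg: "0 \<le> inner (D x) x"
proof -
  have "(norm (blinfun_apply T x))\<^sup>2 \<le> (R * norm x)\<^sup>2" by (intro power_mono norm_T) simp
  then show ?thesis using R(2) by (simp add: inner_D power_mult_distrib divide_le_eq mult.commute)
qed

text \<open>In the expanded square the last term, with T' T x, is at most half the negative middle
  term, by the bound on T'.\<close>

lemma norm_D: "norm (D x) \<le> norm x"
proof (rule power2_le_imp_le)
  let ?T = "blinfun_apply T x"
  have "norm (blinfun_apply T' ?T) \<le> R * norm ?T"
    using norm_T by (rule norm_T'_le)
  then have "(norm (blinfun_apply T' ?T))\<^sup>2 \<le> (R * norm ?T)\<^sup>2" by (intro power_mono) auto
  then have *: "(norm (blinfun_apply T' ?T))\<^sup>2 / R\<^sup>2 \<le> (norm ?T)\<^sup>2"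
    using R(2) by (simp add: power_mult_distrib divide_le_eq mult.commute)
  have "(norm (D x))\<^sup>2 = (norm x)\<^sup>2 - 2 * ((norm ?T)\<^sup>2 / R\<^sup>2) + (norm (blinfun_apply T' ?T))\<^sup>2 / R\<^sup>2 / R\<^sup>2"
  proof -
    have "inner x (blinfun_apply T' ?T) = (norm ?T)\<^sup>2"
      by (simp add: adjoint[symmetric] power2_norm_eq_inner)
    then show ?thesis
      unfolding D_def norm_diff_power2 by (simp add: power2_eq_square)
  qed
  also have "\<dots> \<le> (norm x)\<^sup>2 - 2 * ((norm ?T)\<^sup>2 / R\<^sup>2) + (norm ?T)\<^sup>2 / R\<^sup>2"
    using * by (intro add_left_mono divide_right_mono) auto
  also have "\<dots> \<le> (norm x)\<^sup>2" by simp
  finally show "(norm (D x))\<^sup>2 \<le> (norm x)\<^sup>2" .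
qed simp

lemma funpow_D_diff: "(D ^^ n) (x - y) = (D ^^ n) x - (D ^^ n) y"
  by (induction n) (simp_all add: D_diff)

lemma inner_funpow_D: "inner ((D ^^ n) x) y = inner x ((D ^^ n) y)"
  by (induction n arbitrary: x y) (simp_all add: D_symmetric funpow_swap1)

lemma inner_funpow_D_add: "inner ((D ^^ (j + k)) x) y = inner ((D ^^ j) x) ((D ^^ k) y)"
  by (simp add: add.commute[of j] funpow_add inner_funpow_D)

text \<open>Symmetry of \<open>D\<close> splits the power in the middle: an even power gives a
  squared norm, an odd one the quadratic form of \<open>D\<close> itself. No square root of
  \<open>D\<close> is involved.\<close>

lemma funpow_D_nonneg: "0 \<le> inner ((D ^^ n) x) x"
proof (cases "even n")
  case True
  then obtain k where "n = k + k" by (metis evenE mult_2)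
  then have "inner ((D ^^ n) x) x = inner ((D ^^ k) x) ((D ^^ k) x)"
    by (simp only: inner_funpow_D_add)
  then show ?thesis by simp
next
  case False
  then obtain k where "n = Suc k + k" by (metis oddE mult_2 add_Suc Suc_eq_plus1)
  then have "inner ((D ^^ n) x) x = inner (D ((D ^^ k) x)) ((D ^^ k) x)"
    by (simp only: inner_funpow_D_add funpow.simps o_apply)
  then show ?thesis using D_nonneg by simp
qed

text \<open>The moments \<open>c j = \<langle>D\<^sup>j x, x\<rangle>\<close> form a nonnegative convex sequence, so their decrements are at most
  \<open>c 0 / (j + 1)\<close>; this is the operator form of \<open>t (1 - t)\<^sup>2\<^sup>N \<le> 1 / (2 N + 1)\<close> on the unit interval.\<close>

lemma norm_T_funpow_D:
  "(norm (blinfun_apply T ((D ^^ N) x)))\<^sup>2 \<le> R\<^sup>2 / (2 * N + 1) * (norm x)\<^sup>2"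
proof -
  define c where "c j = inner ((D ^^ j) x) x" for j
  have c_nonneg: "0 \<le> c j" for j unfolding c_def by (rule funpow_D_nonneg)
  \<comment> \<open>The second difference is the quadratic form of \<open>D ^^ j\<close> at
    \<open>x - D x\<close>, hence nonnegative.\<close>
  have "c j - c (Suc j) - (c (Suc j) - c (Suc (Suc j))) = inner ((D ^^ j) (x - D x)) (x - D x)" for j
  proof -
    have "inner ((D ^^ j) x) (D x) = c (Suc j)" "inner ((D ^^ j) (D x)) x = c (Suc j)"
      "inner ((D ^^ j) (D x)) (D x) = c (Suc (Suc j))"
      using inner_funpow_D_add[of j 1 x x] inner_funpow_D_add[of "Suc j" 1 x x]
      by (simp_all add: c_def funpow_swap1)
    then show ?thesis by (simp add: c_def funpow_D_diff inner_diff)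
  qed
  then have "c (Suc j) - c (Suc (Suc j)) \<le> c j - c (Suc j)" for j
    using funpow_D_nonneg[of j "x - D x"] by (metis diff_ge_0_iff_ge)
  then have anti: "antimono (\<lambda>j. c j - c (Suc j))" by (rule decseq_SucI[unfolded antimono_def[symmetric]])
  \<comment> \<open>There are 2 N + 1 decrements, with indices 0 to 2 N, and the last is the
    smallest. It is also the one that, times \<open>R\<^sup>2\<close>, gives the squared norm on the
    left of the claim.\<close>
  have "(2 * N + 1) * (c (2 * N) - c (Suc (2 * N))) = (\<Sum>j<2 * N + 1. c (2 * N) - c (Suc (2 * N)))"
    by simp
  also have "\<dots> \<le> (\<Sum>j<2 * N + 1. c j - c (Suc j))"
    by (intro sum_mono antimonoD[OF anti]) auto
  also have "\<dots> = c 0 - c (2 * N + 1)" by (rule sum_lessThan_telescope')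
  also have "\<dots> \<le> (norm x)\<^sup>2" using c_nonneg[of "2 * N + 1"] by (simp add: c_def[of 0] power2_norm_eq_inner)
  finally have *: "c (2 * N) - c (Suc (2 * N)) \<le> (norm x)\<^sup>2 / (2 * N + 1)"
    by (simp add: field_simps)
  let ?y = "(D ^^ N) x"
  have "(norm (blinfun_apply T ?y))\<^sup>2 = R\<^sup>2 * (inner ?y ?y - inner (D ?y) ?y)"
    using R(2) by (simp add: inner_D power2_norm_eq_inner)
  also have "inner ?y ?y - inner (D ?y) ?y = c (2 * N) - c (Suc (2 * N))"
    using inner_funpow_D_add[of N N x x] inner_funpow_D_add[of "Suc N" N x x]
    by (simp add: c_def mult_2)
  finally show ?thesis using mult_left_mono[OF *, of "R\<^sup>2"] by simp
qed

text \<open>Here 1 - D = T' T / R^2 has norm at most \<epsilon>^2 / R^2, and \<open>D\<close> is a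
  contraction, so telescoping bounds the distance of the N-th power from the identity by N times
  that.\<close>

lemma norm_T_diff_funpow_D:
  assumes \<epsilon>: "\<And>x. norm (blinfun_apply T x) \<le> \<epsilon> * norm x" "0 \<le> \<epsilon>"
  shows "norm (blinfun_apply T x - blinfun_apply T ((D ^^ N) x)) \<le> \<epsilon> * (N * (\<epsilon>\<^sup>2 / R\<^sup>2)) * norm x"
proof -
  have one: "norm (y - D y) \<le> \<epsilon>\<^sup>2 / R\<^sup>2 * norm y" for y
  proof -
    have "norm (blinfun_apply T' (blinfun_apply T y)) \<le> \<epsilon> * (\<epsilon> * norm y)"
      using norm_T'_le[OF \<epsilon>(1), of "blinfun_apply T y"] mult_left_mono[OF \<epsilon>(1)[of y] \<epsilon>(2)] by linarith
    then show ?thesis using R(2) by (simp add: D_def power2_eq_square divide_right_mono)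
  qed
  have pow: "norm ((D ^^ n) y) \<le> norm y" for n y
    by (induction n) (auto intro: order_trans[OF norm_D])
  have "norm (x - (D ^^ N) x) \<le> N * (\<epsilon>\<^sup>2 / R\<^sup>2 * norm x)"
  proof (induction N)
    case (Suc N)
    have "norm (x - (D ^^ Suc N) x) \<le> norm (x - (D ^^ N) x) + norm ((D ^^ N) x - D ((D ^^ N) x))"
      using norm_triangle_ineq[of "x - (D ^^ N) x" "(D ^^ N) x - D ((D ^^ N) x)"] by simp
    also have "norm ((D ^^ N) x - D ((D ^^ N) x)) \<le> \<epsilon>\<^sup>2 / R\<^sup>2 * norm x"
      using one[of "(D ^^ N) x"] mult_left_mono[OF pow[of N x], of "\<epsilon>\<^sup>2 / R\<^sup>2"] by simp
    finally show ?case using Suc by (simp add: algebra_simps add_divide_distrib)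
  qed simp
  then have "\<epsilon> * norm (x - (D ^^ N) x) \<le> \<epsilon> * (N * (\<epsilon>\<^sup>2 / R\<^sup>2 * norm x))"
    using \<epsilon>(2) by (intro mult_left_mono)
  moreover have "norm (blinfun_apply T x - blinfun_apply T ((D ^^ N) x)) \<le> \<epsilon> * norm (x - (D ^^ N) x)"
    using \<epsilon>(1)[of "x - (D ^^ N) x"] by (simp add: blinfun.diff_right)
  ultimately show ?thesis by (simp add: mult.assoc)
qed

end

section \<open>Lifting elements of small quotient norm\<close>

text \<open>Multiplied out recursively, the product stays finitely supported and uses no unit. It
  depends only on \<open>a\<close> and \<open>R\<close>, so one element serves the regular and all
  quasi-regular representations simultaneously.\<close>

primrec truncation ::
  "('a, 'b) monoid_scheme \<Rightarrow> real \<Rightarrow> ('a \<Rightarrow> complex) \<Rightarrow> nat \<Rightarrow> 'a \<Rightarrow> complex"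
where
  "truncation G R a 0 = a"
| "truncation G R a (Suc n) = (\<lambda>g. truncation G R a n g - complex_of_real (1 / R\<^sup>2) *
    convolution G (truncation G R a n) (convolution G (involution G a) a) g)"

lemma (in group) group_algebra_truncation:
  assumes "a \<in> group_algebra G"
  shows "truncation G R a n \<in> group_algebra G"
  using assms
  by (induction n) (simp_all add: group_algebra_diff group_algebra_scale
      group_algebra_convolution[OF is_group] group_algebra_involution[OF is_group] del: of_real_divide)

context group_set
begin

lemma adjoint_pair_algebra_rep:
  assumes "a \<in> group_algebra G" "norm (algebra_rep (action_rep G S act) a) \<le> R" "0 < R"
  shows "adjoint_pair (algebra_rep (action_rep G S act) a)
    (algebra_rep (action_rep G S act) (involution G a)) R"
  using assms by unfold_locales (simp_all add: inner_algebra_rep)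

lemma algebra_rep_truncation:
  assumes a: "a \<in> group_algebra G" and R: "norm (algebra_rep (action_rep G S act) a) \<le> R" "0 < R"
  shows "blinfun_apply (algebra_rep (action_rep G S act) (truncation G R a n)) x =
    blinfun_apply (algebra_rep (action_rep G S act) a)
      ((adjoint_pair.D (algebra_rep (action_rep G S act) a)
        (algebra_rep (action_rep G S act) (involution G a)) R ^^ n) x)"
proof -
  interpret A: adjoint_pair "algebra_rep (action_rep G S act) a"
    "algebra_rep (action_rep G S act) (involution G a)" R
    using assms by (rule adjoint_pair_algebra_rep)
  note ga = group_algebra_truncation[OF a] group_algebra_involution[OF is_group a] a
    group_algebra_convolution[OF is_group]
  show ?thesis
  \<comment> \<open>The new factor acts first, so the induction hypothesis is applied at
    \<open>A.D x\<close>.\<close>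
  proof (induction n arbitrary: x)
    case (Suc n)
    let ?\<rho> = "\<lambda>a. algebra_rep (action_rep G S act) a"
    have "blinfun_apply (?\<rho> (truncation G R a (Suc n))) x =
        blinfun_apply (?\<rho> (truncation G R a n)) x -
        (1 / R\<^sup>2) *\<^sub>R blinfun_apply (?\<rho> (truncation G R a n))
          (blinfun_apply (?\<rho> (involution G a)) (blinfun_apply (?\<rho> a) x))"
      unfolding truncation.simps
      by (subst algebra_rep_diff[where G = G])
        (simp_all add: ga group_algebra_scale algebra_rep_scale[where G = G] algebra_rep_convolution
          blinfun.diff_left blinfun.scaleR_left del: of_real_divide)
    also have "\<dots> = blinfun_apply (?\<rho> (truncation G R a n)) (A.D x)"
      by (simp add: A.D_def blinfun.diff_right blinfun.scaleR_right)
    also have "\<dots> = blinfun_apply (?\<rho> a) ((A.D ^^ Suc n) x)"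
      by (simp add: Suc.IH funpow_swap1)
    finally show ?case .
  qed simp
qed

lemma norm_truncation_le:
  assumes a: "a \<in> group_algebra G" and R: "norm (algebra_rep (action_rep G S act) a) \<le> R" "0 < R"
    and \<delta>: "R\<^sup>2 \<le> (2 * N + 1) * \<delta>\<^sup>2" "0 \<le> \<delta>"
  shows "norm (algebra_rep (action_rep G S act) (truncation G R a N)) \<le> \<delta>"
proof (rule norm_blinfun_bound[OF \<delta>(2)])
  fix x
  interpret A: adjoint_pair "algebra_rep (action_rep G S act) a"
    "algebra_rep (action_rep G S act) (involution G a)" R
    using a R by (rule adjoint_pair_algebra_rep)
  have "(norm (blinfun_apply (algebra_rep (action_rep G S act) (truncation G R a N)) x))\<^sup>2 \<le>
      R\<^sup>2 / (2 * N + 1) * (norm x)\<^sup>2"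
    unfolding algebra_rep_truncation[OF a R] by (rule A.norm_T_funpow_D)
  also have "\<dots> \<le> \<delta>\<^sup>2 * (norm x)\<^sup>2"
    using \<delta>(1) by (intro mult_right_mono) (simp_all add: divide_le_eq mult.commute)
  finally have "(norm (blinfun_apply (algebra_rep (action_rep G S act) (truncation G R a N)) x))\<^sup>2 \<le> (\<delta> * norm x)\<^sup>2"
    by (simp add: power_mult_distrib)
  then show "norm (blinfun_apply (algebra_rep (action_rep G S act) (truncation G R a N)) x) \<le> \<delta> * norm x"
    by (rule power2_le_imp_le) (simp add: \<delta>(2))
qed

lemma norm_diff_truncation_le:
  assumes a: "a \<in> group_algebra G" and \<epsilon>: "norm (algebra_rep (action_rep G S act) a) \<le> \<epsilon>" "\<epsilon> \<le> R" "0 < R"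
    and N: "N * \<epsilon>\<^sup>2 \<le> R\<^sup>2 / 2"
  shows "norm (algebra_rep (action_rep G S act) (\<lambda>g. a g - truncation G R a N g)) \<le> \<epsilon> / 2"
proof (rule norm_blinfun_bound)
  have \<epsilon>0: "0 \<le> \<epsilon>" using \<epsilon>(1) norm_ge_zero order_trans by blast
  then show "0 \<le> \<epsilon> / 2" by simp
  fix x
  have R: "norm (algebra_rep (action_rep G S act) a) \<le> R" using \<epsilon>(1,2) by simp
  interpret A: adjoint_pair "algebra_rep (action_rep G S act) a"
    "algebra_rep (action_rep G S act) (involution G a)" R
    using a R \<epsilon>(3) by (rule adjoint_pair_algebra_rep)
  have bound: "norm (blinfun_apply (algebra_rep (action_rep G S act) a) x) \<le> \<epsilon> * norm x" for x
    using norm_blinfun \<epsilon>(1) by (meson mult_right_mono norm_ge_zero order_trans)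
  have "norm (blinfun_apply (algebra_rep (action_rep G S act) (\<lambda>g. a g - truncation G R a N g)) x) \<le>
      \<epsilon> * (N * (\<epsilon>\<^sup>2 / R\<^sup>2)) * norm x"
    unfolding algebra_rep_diff[OF a group_algebra_truncation[OF a]] blinfun.diff_left
      algebra_rep_truncation[OF a R \<epsilon>(3)]
    by (rule A.norm_T_diff_funpow_D[OF bound \<epsilon>0])
  also have "\<dots> \<le> \<epsilon> * (1 / 2) * norm x"
    using N \<epsilon>(3) \<epsilon>0 by (intro mult_right_mono mult_left_mono) (simp_all add: divide_le_eq)
  finally show "norm (blinfun_apply (algebra_rep (action_rep G S act) (\<lambda>g. a g - truncation G R a N g)) x)
      \<le> \<epsilon> / 2 * norm x" by simp
qed

end

context group
begin

interpretation R: group_set G "carrier G" "(\<otimes>)" by (rule group_set_regular)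

text \<open>The element \<open>b\<close> is \<open>a\<close> minus its truncation: the truncation is
  small in the regular representation and close to \<open>a\<close> in the quasi-regular
  ones.\<close>

lemma halve_quasi_regular_norm:
  assumes a: "a \<in> group_algebra G" and \<epsilon>: "0 < \<epsilon>"
    and \<X>: "\<And>X. X \<in> \<X> \<Longrightarrow> subgroup X G" "\<And>X. X \<in> \<X> \<Longrightarrow> norm (algebra_rep (quasi_regular G X) a) \<le> \<epsilon>"
  obtains b where "b \<in> group_algebra G"
    "norm (algebra_rep (left_regular G) a - algebra_rep (left_regular G) b) \<le> 2 * \<epsilon>"
    "\<And>X. X \<in> \<X> \<Longrightarrow> norm (algebra_rep (quasi_regular G X) b) \<le> \<epsilon> / 2"
proof -
  \<comment> \<open>Adding \<epsilon> makes \<open>R\<close> positive and at least \<epsilon>, as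
    the two truncation estimates require.\<close>
  define R where "R = norm (algebra_rep (left_regular G) a) + \<epsilon>"
  have R: "norm (algebra_rep (left_regular G) a) \<le> R" "\<epsilon> \<le> R" "0 < R"
    using \<epsilon> by (auto simp: R_def add_nonneg_pos)
  \<comment> \<open>The largest exponent allowed by the halving estimate. Since N + 1 exceeds the
    bound, (2 N + 2) \<epsilon>^2 > R^2, which is more than the estimate with 2 \<epsilon> asks
    for.\<close>
  define N where "N = nat \<lfloor>R\<^sup>2 / (2 * \<epsilon>\<^sup>2)\<rfloor>"
  have N_le: "N \<le> R\<^sup>2 / (2 * \<epsilon>\<^sup>2)" and N_gt: "R\<^sup>2 / (2 * \<epsilon>\<^sup>2) < N + 1"
    unfolding N_def by (simp_all add: of_nat_floor) linarith
  define b where "b = (\<lambda>g. a g - truncation G R a N g)"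
  have b: "b \<in> group_algebra G"
    unfolding b_def by (intro group_algebra_diff a group_algebra_truncation)
  have "R\<^sup>2 < (N + 1) * (2 * \<epsilon>\<^sup>2)" using N_gt \<epsilon> by (simp add: divide_less_eq)
  also have "\<dots> \<le> (2 * N + 1) * (2 * \<epsilon>)\<^sup>2"
    by (simp add: power_mult_distrib algebra_simps)
  finally have "norm (algebra_rep (left_regular G) (truncation G R a N)) \<le> 2 * \<epsilon>"
    using R \<epsilon> a unfolding left_regular_eq by (intro R.norm_truncation_le) auto
  moreover have "algebra_rep (left_regular G) b =
      algebra_rep (left_regular G) a - algebra_rep (left_regular G) (truncation G R a N)"
    unfolding b_def by (rule algebra_rep_diff[OF a group_algebra_truncation[OF a]])
  ultimately have "norm (algebra_rep (left_regular G) a - algebra_rep (left_regular G) b) \<le> 2 * \<epsilon>"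
    by simp
  moreover have "norm (algebra_rep (quasi_regular G X) b) \<le> \<epsilon> / 2" if "X \<in> \<X>" for X
  proof -
    interpret X: group_set G "lcosets X" "\<lambda>g C. g <#\<^bsub>G\<^esub> C"
      using \<X>(1)[OF that] by (rule group_set_lcosets)
    show ?thesis
      using \<X>(2)[OF that] R N_le \<epsilon> a unfolding quasi_regular_eq b_def
      by (intro X.norm_diff_truncation_le) (simp_all add: field_simps)
  qed
  ultimately show ?thesis using that b by blast
qed

text \<open>The choice in \<open>quasi_regular_ext\<close> needs a witness: domination by the
  regular norm makes the map on the group algebra well defined and 1-Lipschitz, so it extends to the
  closure.\<close>

lemma quasi_regular_ext_props:
  assumes le: "\<And>a. a \<in> group_algebra G \<Longrightarrow>
    norm (algebra_rep (quasi_regular G X) a) \<le> norm (algebra_rep (left_regular G) a)"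
  shows "continuous_on (reduced_cstar G) (quasi_regular_ext G X)"
    and "a \<in> group_algebra G \<Longrightarrow>
      quasi_regular_ext G X (algebra_rep (left_regular G) a) = algebra_rep (quasi_regular G X) a"
proof -
  let ?l = "algebra_rep (left_regular G)" and ?q = "algebra_rep (quasi_regular G X)"
  let ?P = "\<lambda>\<phi>. continuous_on (reduced_cstar G) \<phi> \<and> (\<forall>a\<in>group_algebra G. \<phi> (?l a) = ?q a)"
  have diff: "norm (?q a - ?q b) \<le> norm (?l a - ?l b)"
    if "a \<in> group_algebra G" "b \<in> group_algebra G" for a b
    using le[OF group_algebra_diff[OF that]] algebra_rep_diff[OF that] by metis
  define \<phi> where "\<phi> = (\<lambda>T. ?q (SOME a. a \<in> group_algebra G \<and> ?l a = T))"
  have \<phi>: "\<phi> (?l a) = ?q a" if a: "a \<in> group_algebra G" for a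
  proof -
    have "(SOME b. b \<in> group_algebra G \<and> ?l b = ?l a) \<in> group_algebra G \<and>
        ?l (SOME b. b \<in> group_algebra G \<and> ?l b = ?l a) = ?l a"
      by (rule someI[of _ a]) (simp add: a)
    then show ?thesis
      using diff[OF _ a, of "SOME b. b \<in> group_algebra G \<and> ?l b = ?l a"] by (simp add: \<phi>_def)
  qed
  have "uniformly_continuous_on (group_algebra_ops G) \<phi>"
    unfolding uniformly_continuous_on_def
  proof (intro allI impI)
    fix e :: real assume "0 < e"
    then show "\<exists>d>0. \<forall>x\<in>group_algebra_ops G. \<forall>x'\<in>group_algebra_ops G. dist x' x < d \<longrightarrow> dist (\<phi> x') (\<phi> x) < e"
      using diff by (intro exI[of _ e]) (auto simp: group_algebra_ops_def \<phi> dist_norm intro: le_less_trans)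
  qed
  then obtain \<psi> where "uniformly_continuous_on (closure (group_algebra_ops G)) \<psi>"
    "\<And>T. T \<in> group_algebra_ops G \<Longrightarrow> \<phi> T = \<psi> T"
    by (rule uniformly_continuous_on_extension_on_closure) blast
  then have "?P \<psi>"
    using \<phi> by (auto simp: reduced_cstar_def group_algebra_ops_def uniformly_continuous_imp_continuous)
  then have "?P (quasi_regular_ext G X)"
    unfolding quasi_regular_ext_def by (rule someI[where P = ?P])
  then show "continuous_on (reduced_cstar G) (quasi_regular_ext G X)"
    and "a \<in> group_algebra G \<Longrightarrow> quasi_regular_ext G X (?l a) = ?q a"
    by auto
qed

text \<open>Contractivity passes to the closure along an approximating sequence. Comparing only with
  elements of the group algebra avoids proving that the chosen extension is linear.\<close>

lemma norm_quasi_regular_ext_diff_le: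
  assumes le: "\<And>a. a \<in> group_algebra G \<Longrightarrow>
    norm (algebra_rep (quasi_regular G X) a) \<le> norm (algebra_rep (left_regular G) a)"
    and T: "T \<in> reduced_cstar G" and a: "a \<in> group_algebra G"
  shows "norm (quasi_regular_ext G X T - algebra_rep (quasi_regular G X) a) \<le>
    norm (T - algebra_rep (left_regular G) a)"
proof -
  let ?l = "algebra_rep (left_regular G)" and ?q = "algebra_rep (quasi_regular G X)"
  obtain x where x: "\<And>n. x n \<in> group_algebra_ops G" "x \<longlonglongrightarrow> T"
    using T unfolding reduced_cstar_def closure_sequential by blast
  have "\<forall>n. \<exists>b. b \<in> group_algebra G \<and> x n = ?l b"
    using x(1) by (auto simp: group_algebra_ops_def)
  then obtain b where b: "\<And>n. b n \<in> group_algebra G" "\<And>n. x n = ?l (b n)" by metis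
  have mem: "x n \<in> reduced_cstar G" for n
    using x(1) closure_subset unfolding reduced_cstar_def by blast
  have "(\<lambda>n. quasi_regular_ext G X (x n)) \<longlonglongrightarrow> quasi_regular_ext G X T"
    using continuous_on_tendsto_compose[OF quasi_regular_ext_props(1)[OF le] x(2) T] mem by simp
  then have "(\<lambda>n. ?q (b n)) \<longlonglongrightarrow> quasi_regular_ext G X T"
    using quasi_regular_ext_props(2)[OF le] b by simp
  then have lim: "(\<lambda>n. norm (?q (b n) - ?q a)) \<longlonglongrightarrow> norm (quasi_regular_ext G X T - ?q a)"
    "(\<lambda>n. norm (x n - ?l a)) \<longlonglongrightarrow> norm (T - ?l a)"
    by (intro tendsto_intros x(2); assumption)+
  show ?thesis
  proof (rule LIMSEQ_le[OF lim])
    have "norm (?q (b n) - ?q a) \<le> norm (x n - ?l a)" for n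
      using le[OF group_algebra_diff[OF b(1)[of n] a]] algebra_rep_diff[OF b(1)[of n] a]
      by (metis b(2))
    then show "\<exists>N. \<forall>n\<ge>N. norm (?q (b n) - ?q a) \<le> norm (x n - ?l a)" by blast
  qed
qed

lemma J_ideal_iff:
  "T \<in> J_ideal G \<X> \<longleftrightarrow> T \<in> reduced_cstar G \<and> (\<forall>X\<in>\<X>. quasi_regular_ext G X T = 0)"
  by (auto simp: J_ideal_def quasi_regular_kernel_def)

text \<open>In C*-algebraic terms: the norm of \<open>a\<close> modulo the ideal is the norm of its image, up to the
  factor \<open>4\<close>.\<close>

lemma J_ideal_near:
  assumes a: "a \<in> group_algebra G" and \<epsilon>: "0 < \<epsilon>"
    and \<X>: "\<And>X. X \<in> \<X> \<Longrightarrow> subgroup X G" "\<And>X. X \<in> \<X> \<Longrightarrow> norm (algebra_rep (quasi_regular G X) a) \<le> \<epsilon>"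
    and le: "\<And>X a. X \<in> \<X> \<Longrightarrow> a \<in> group_algebra G \<Longrightarrow>
      norm (algebra_rep (quasi_regular G X) a) \<le> norm (algebra_rep (left_regular G) a)"
  obtains T where "T \<in> J_ideal G \<X>" "norm (T - algebra_rep (left_regular G) a) \<le> 4 * \<epsilon>"
proof -
  let ?l = "algebra_rep (left_regular G)" and ?q = "\<lambda>X. algebra_rep (quasi_regular G X)"
  \<comment> \<open>The clause for n = 0 pins the start of the sequence to \<open>a\<close>, so that
    the telescoped series measures the distance from \<open>a\<close>.\<close>
  let ?P = "\<lambda>n b. b \<in> group_algebra G \<and> (n = 0 \<longrightarrow> b = a) \<and> (\<forall>X\<in>\<X>. norm (?q X b) \<le> \<epsilon> / 2 ^ n)"
  let ?Q = "\<lambda>n b c. norm (?l b - ?l c) \<le> 2 * (\<epsilon> / 2 ^ n)"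
  have "\<exists>b. \<forall>n. ?P n (b n) \<and> ?Q n (b n) (b (Suc n))"
  proof (rule dependent_nat_choice)
    show "\<exists>b. ?P 0 b" using a \<X>(2) by auto
    fix b n assume b: "?P n b"
    have "0 < \<epsilon> / 2 ^ n" using \<epsilon> by simp
    from halve_quasi_regular_norm[OF _ this, of b \<X>] b \<X>(1)
    obtain c where "c \<in> group_algebra G" "?Q n b c" "\<And>X. X \<in> \<X> \<Longrightarrow> norm (?q X c) \<le> \<epsilon> / 2 ^ n / 2"
      by blast
    then show "\<exists>c. ?P (Suc n) c \<and> ?Q n b c" by (auto simp: field_simps)
  qed
  then obtain b where b: "\<And>n. b n \<in> group_algebra G" "b 0 = a"
    "\<And>n X. X \<in> \<X> \<Longrightarrow> norm (?q X (b n)) \<le> \<epsilon> / 2 ^ n"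
    "\<And>n. norm (?l (b n) - ?l (b (Suc n))) \<le> 2 * (\<epsilon> / 2 ^ n)" by blast
  define d where "d n = ?l (b (Suc n)) - ?l (b n)" for n
  have d: "norm (d n) \<le> (2 * \<epsilon>) * (1 / 2) ^ n" for n
    using b(4)[of n] by (simp add: d_def norm_minus_commute power_one_over)
  have geo: "(\<lambda>n. (2 * \<epsilon>) * (1 / 2) ^ n) sums (4 * \<epsilon>)"
    using sums_mult[OF geometric_sums[of "1 / 2 :: real"], of "2 * \<epsilon>"] by simp
  have sm: "summable d"
    by (rule summable_comparison_test'[OF sums_summable[OF geo], of 0]) (rule d)
  define T where "T = ?l a + suminf d"
  have "(\<lambda>n. ?l a + (\<Sum>i<n. d i)) \<longlonglongrightarrow> T"
    unfolding T_def by (intro tendsto_intros summable_LIMSEQ sm)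
  moreover have "?l a + (\<Sum>i<n. d i) = ?l (b n)" for n
    unfolding d_def sum_lessThan_telescope[of "\<lambda>n. ?l (b n)"] by (simp add: b(2))
  ultimately have lim: "(\<lambda>n. ?l (b n)) \<longlonglongrightarrow> T" by simp
  have T: "T \<in> reduced_cstar G"
    unfolding reduced_cstar_def closure_sequential
    by (rule exI[of _ "\<lambda>n. ?l (b n)"]) (use b(1) lim in \<open>auto simp: group_algebra_ops_def\<close>)
  have "quasi_regular_ext G X T = 0" if X: "X \<in> \<X>" for X
  proof -
    have "norm (quasi_regular_ext G X T) \<le> norm (T - ?l (b n)) + \<epsilon> * (1 / 2) ^ n" for n
      using norm_quasi_regular_ext_diff_le[OF le[OF X] T b(1)[of n]] b(3)[OF X, of n]
        norm_triangle_sub[of "quasi_regular_ext G X T" "?q X (b n)"] by (simp add: power_one_over)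
    moreover have "(\<lambda>n. norm (T - ?l (b n)) + \<epsilon> * (1 / 2) ^ n) \<longlonglongrightarrow> norm (T - T) + \<epsilon> * 0"
      by (intro tendsto_intros lim LIMSEQ_power_zero) simp
    ultimately have "norm (quasi_regular_ext G X T) \<le> norm (T - T) + \<epsilon> * 0"
      by (intro LIMSEQ_le_const) auto
    then show ?thesis by simp
  qed
  then have "T \<in> J_ideal G \<X>" using T by (simp add: J_ideal_iff)
  moreover have "norm (T - ?l a) \<le> 4 * \<epsilon>"
  proof -
    have "norm (suminf d) \<le> suminf (\<lambda>n. (2 * \<epsilon>) * (1 / 2) ^ n)"
      by (rule norm_suminf_le[OF d sums_summable[OF geo]])
    then show ?thesis using sums_unique[OF geo] by (simp add: T_def)
  qed
  ultimately show ?thesis by (rule that)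
qed

end

section \<open>Restriction to subgroups\<close>

text \<open>This is where monotonicity of the subgroups enters: the finite support of a group
  algebra element lies in one of them.\<close>

lemma finite_subset_incseq_UN:
  fixes \<Lambda> :: "nat \<Rightarrow> 'a set"
  assumes "finite F" "F \<subseteq> (\<Union>n. \<Lambda> n)" "incseq \<Lambda>"
  shows "\<exists>n. F \<subseteq> \<Lambda> n"
  using assms(1,2)
proof (induction F)
  case (insert x F)
  then obtain m n where mn: "x \<in> \<Lambda> m" "F \<subseteq> \<Lambda> n" by auto
  have "\<Lambda> m \<subseteq> \<Lambda> (max m n)" "\<Lambda> n \<subseteq> \<Lambda> (max m n)"
    using assms(3) by (auto simp: incseq_def)
  then show ?case using mn by (intro exI[of _ "max m n"]) auto
qed simp

context group
begin

lemma group_algebra_subgroup: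
  assumes "subgroup \<Lambda> G"
  shows "a \<in> group_algebra (G\<lparr>carrier := \<Lambda>\<rparr>) \<longleftrightarrow> finite {g. a g \<noteq> 0} \<and> {g. a g \<noteq> 0} \<subseteq> \<Lambda>"
    and "a \<in> group_algebra (G\<lparr>carrier := \<Lambda>\<rparr>) \<Longrightarrow> a \<in> group_algebra G"
  using subgroup.subset[OF assms] by (auto simp: group_algebra_def)

lemma group_set_subgroup:
  assumes "subgroup \<Lambda> G" "group_set G S act"
  shows "group_set (G\<lparr>carrier := \<Lambda>\<rparr>) S act"
proof -
  interpret S: group_set G S act by fact
  interpret H: group "G\<lparr>carrier := \<Lambda>\<rparr>" using assms(1) by (rule subgroup_imp_group)
  show ?thesis
    using subgroup.subset[OF assms(1)]
    by unfold_locales (auto simp: S.act_one intro!: S.act_closed S.act_mult)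
qed

lemma algebra_rep_action_rep_subgroup:
  assumes "subgroup \<Lambda> G" "a \<in> group_algebra (G\<lparr>carrier := \<Lambda>\<rparr>)"
  shows "algebra_rep (action_rep (G\<lparr>carrier := \<Lambda>\<rparr>) S act) a = algebra_rep (action_rep G S act) a"
  using assms
  by (intro algebra_rep_cong)
    (auto simp: action_rep_def group_algebra_subgroup[OF assms(1)] m_inv_consistent)

text \<open>Left translation of \<Lambda> on the whole group is free, so it yields the norm of the
  regular representation of \<Lambda>.\<close>

lemma norm_left_regular_subgroup:
  assumes \<Lambda>: "subgroup \<Lambda> G" and a: "a \<in> group_algebra (G\<lparr>carrier := \<Lambda>\<rparr>)"
  shows "norm (algebra_rep (left_regular (G\<lparr>carrier := \<Lambda>\<rparr>)) a) = norm (algebra_rep (left_regular G) a)"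
proof -
  interpret H: group_set "G\<lparr>carrier := \<Lambda>\<rparr>" "carrier G" "(\<otimes>)"
    using \<Lambda> group_set_regular by (rule group_set_subgroup)
  have "norm (algebra_rep (action_rep (G\<lparr>carrier := \<Lambda>\<rparr>) (carrier G) (\<otimes>)) a) =
      norm (algebra_rep (left_regular (G\<lparr>carrier := \<Lambda>\<rparr>)) a)"
    using subgroup.subset[OF \<Lambda>] by (intro H.norm_free_action_rep a) auto
  then show ?thesis
    by (simp add: algebra_rep_action_rep_subgroup[OF \<Lambda> a] left_regular_eq[of G])
qed

lemma mem_lcoset_iff:
  assumes "X \<subseteq> carrier G" "g \<in> carrier G" "h \<in> carrier G"
  shows "h \<in> g <#\<^bsub>G\<^esub> X \<longleftrightarrow> inv g \<otimes> h \<in> X"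
proof
  assume "h \<in> g <#\<^bsub>G\<^esub> X"
  then obtain x where "x \<in> X" "h = g \<otimes> x" by (auto simp: l_coset_def)
  moreover have "inv g \<otimes> (g \<otimes> x) = x" if "x \<in> carrier G" for x
    using that assms(2) by (simp flip: m_assoc)
  ultimately show "inv g \<otimes> h \<in> X" using assms(1) by auto
next
  assume "inv g \<otimes> h \<in> X"
  moreover have "h = g \<otimes> (inv g \<otimes> h)"
    using assms(2,3) by (simp flip: m_assoc)
  ultimately show "h \<in> g <#\<^bsub>G\<^esub> X" unfolding l_coset_def by blast
qed

lemma mem_conjugate_iff:
  assumes "X \<subseteq> carrier G" "g \<in> carrier G" "h \<in> carrier G"
  shows "h \<in> g <#\<^bsub>G\<^esub> X #>\<^bsub>G\<^esub> inv g \<longleftrightarrow> inv g \<otimes> h \<otimes> g \<in> X"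
proof
  assume "h \<in> g <#\<^bsub>G\<^esub> X #>\<^bsub>G\<^esub> inv g"
  then obtain x where "x \<in> X" "h = g \<otimes> x \<otimes> inv g"
    using assms(1,2) by (auto simp: l_coset_def r_coset_def m_assoc subset_iff)
  moreover have "inv g \<otimes> (g \<otimes> x \<otimes> inv g) \<otimes> g = x" if "x \<in> carrier G" for x
    using that assms(2) by (metis inv_closed l_inv m_assoc m_closed l_one r_one)
  ultimately show "inv g \<otimes> h \<otimes> g \<in> X" using assms(1) by auto
next
  assume "inv g \<otimes> h \<otimes> g \<in> X"
  moreover have "h = g \<otimes> (inv g \<otimes> h \<otimes> g) \<otimes> inv g"
    using assms(2,3) by (metis inv_closed r_inv m_assoc m_closed l_one r_one)
  ultimately show "h \<in> g <#\<^bsub>G\<^esub> X #>\<^bsub>G\<^esub> inv g"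
    using assms(1,2) unfolding l_coset_def r_coset_def by blast
qed

text \<open>An element \<open>h\<close> fixes the coset of \<open>g\<close> exactly when the
  conjugate of \<open>h\<close> by \<open>inv g\<close> lies in \<open>X\<close>. Cosets other than
  \<open>X\<close> itself thus bring in the conjugates of \<open>X\<close>.\<close>

lemma stab_lcoset:
  assumes \<Lambda>: "subgroup \<Lambda> G" and X: "subgroup X G" and g: "g \<in> carrier G"
  shows "group_set.stab (G\<lparr>carrier := \<Lambda>\<rparr>) (\<lambda>h C. h <#\<^bsub>G\<^esub> C) (g <#\<^bsub>G\<^esub> X) =
    \<Lambda> \<inter> (g <#\<^bsub>G\<^esub> X #>\<^bsub>G\<^esub> inv g)"
proof -
  interpret H: group_set "G\<lparr>carrier := \<Lambda>\<rparr>" "lcosets X" "\<lambda>h C. h <#\<^bsub>G\<^esub> C"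
    using \<Lambda> group_set_lcosets[OF X] by (rule group_set_subgroup)
  have XG: "X \<subseteq> carrier G" using X by (rule subgroup.subset)
  have "h <#\<^bsub>G\<^esub> (g <#\<^bsub>G\<^esub> X) = g <#\<^bsub>G\<^esub> X \<longleftrightarrow> h \<in> g <#\<^bsub>G\<^esub> X #>\<^bsub>G\<^esub> inv g"
    if h: "h \<in> carrier G" for h
  proof -
    have "h <#\<^bsub>G\<^esub> (g <#\<^bsub>G\<^esub> X) = g <#\<^bsub>G\<^esub> X \<longleftrightarrow> h \<otimes> g \<in> g <#\<^bsub>G\<^esub> X"
      using lcos_m_assoc[OF XG h g] l_repr_independence[OF _ g X] lcos_self[OF _ X, of "h \<otimes> g"] h g
      by auto
    also have "\<dots> \<longleftrightarrow> inv g \<otimes> (h \<otimes> g) \<in> X"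
      using h g by (intro mem_lcoset_iff XG) auto
    finally show ?thesis using mem_conjugate_iff[OF XG g h] h g by (simp add: m_assoc)
  qed
  then show ?thesis
    using subgroup.subset[OF \<Lambda>] by (auto simp: H.stab_def)
qed

text \<open>The first bound uses only the \<Lambda>-orbit of the base coset. The second needs all
  \<Lambda>-orbits on the coset space, whose stabilizers are traces of conjugates of
  \<open>X\<close>.\<close>

lemma norm_quasi_regular_subgroup_le:
  assumes \<Lambda>: "subgroup \<Lambda> G" and X: "subgroup X G" and a: "a \<in> group_algebra (G\<lparr>carrier := \<Lambda>\<rparr>)"
  shows "norm (algebra_rep (quasi_regular (G\<lparr>carrier := \<Lambda>\<rparr>) (\<Lambda> \<inter> X)) a) \<le> norm (algebra_rep (quasi_regular G X) a)"
    and "0 \<le> B \<Longrightarrow> (\<And>g. g \<in> carrier G \<Longrightarrow>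
        norm (algebra_rep (quasi_regular (G\<lparr>carrier := \<Lambda>\<rparr>) (\<Lambda> \<inter> (g <#\<^bsub>G\<^esub> X #>\<^bsub>G\<^esub> inv g))) a) \<le> B) \<Longrightarrow>
      norm (algebra_rep (quasi_regular G X) a) \<le> B"
proof -
  interpret H: group_set "G\<lparr>carrier := \<Lambda>\<rparr>" "lcosets X" "\<lambda>h C. h <#\<^bsub>G\<^esub> C"
    using \<Lambda> group_set_lcosets[OF X] by (rule group_set_subgroup)
  have XG: "X \<subseteq> carrier G" using X by (rule subgroup.subset)
  have eq: "algebra_rep (action_rep (G\<lparr>carrier := \<Lambda>\<rparr>) (lcosets X) (\<lambda>h C. h <#\<^bsub>G\<^esub> C)) a =
      algebra_rep (quasi_regular G X) a"
    unfolding quasi_regular_eq by (rule algebra_rep_action_rep_subgroup[OF \<Lambda> a])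
  have one: "\<one> <#\<^bsub>G\<^esub> X = X" using XG by (rule lcos_mult_one)
  have "\<one> <#\<^bsub>G\<^esub> X #>\<^bsub>G\<^esub> inv \<one> = X"
    using XG by (simp add: one coset_mult_one)
  then have "H.stab X = \<Lambda> \<inter> X"
    using stab_lcoset[OF \<Lambda> X one_closed] by (simp add: one)
  moreover have "X \<in> lcosets X"
    unfolding LCOSETS_def using one by blast
  ultimately show "norm (algebra_rep (quasi_regular (G\<lparr>carrier := \<Lambda>\<rparr>) (\<Lambda> \<inter> X)) a) \<le>
      norm (algebra_rep (quasi_regular G X) a)"
    using H.norm_quasi_regular_stab_le[OF _ a, of X] by (simp add: eq)
  assume "0 \<le> B" and B: "\<And>g. g \<in> carrier G \<Longrightarrow>
    norm (algebra_rep (quasi_regular (G\<lparr>carrier := \<Lambda>\<rparr>) (\<Lambda> \<inter> (g <#\<^bsub>G\<^esub> X #>\<^bsub>G\<^esub> inv g))) a) \<le> B"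
  have "norm (algebra_rep (quasi_regular (G\<lparr>carrier := \<Lambda>\<rparr>) (H.stab C)) a) \<le> B"
    if C: "C \<in> lcosets X" for C
  proof -
    obtain g where g: "g \<in> carrier G" "C = g <#\<^bsub>G\<^esub> X" using C by (auto simp: LCOSETS_def)
    show ?thesis unfolding g(2) stab_lcoset[OF \<Lambda> X g(1)] by (rule B[OF g(1)])
  qed
  then show "norm (algebra_rep (quasi_regular G X) a) \<le> B"
    using H.norm_action_rep_le[OF a \<open>0 \<le> B\<close>] by (simp add: eq)
qed

lemma norm_quasi_regular_le_left_regular:
  assumes "amenable G" and X: "subgroup X G" and a: "a \<in> group_algebra G"
  shows "norm (algebra_rep (quasi_regular G X) a) \<le> norm (algebra_rep (left_regular G) a)"
  unfolding quasi_regular_eq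
  by (rule group_set.norm_action_rep_le_left_regular[OF group_set_lcosets[OF X] assms(1) a])

text \<open>Domination descends from \<open>G\<close> to \<Lambda>: the quasi-regular norm over
  \<Lambda> is at most that over \<open>G\<close>, which amenability bounds by the regular norm of
  \<open>G\<close>, and this agrees with that of \<Lambda>.\<close>

lemma norm_quasi_regular_subgroup_le_left_regular:
  assumes "amenable G" and \<Lambda>: "subgroup \<Lambda> G" and X: "subgroup X G" "X \<subseteq> \<Lambda>"
    and a: "a \<in> group_algebra (G\<lparr>carrier := \<Lambda>\<rparr>)"
  shows "norm (algebra_rep (quasi_regular (G\<lparr>carrier := \<Lambda>\<rparr>) X) a) \<le>
    norm (algebra_rep (left_regular (G\<lparr>carrier := \<Lambda>\<rparr>)) a)"
proof -
  have "\<Lambda> \<inter> X = X" using X(2) by blast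
  then show ?thesis
    using norm_quasi_regular_subgroup_le(1)[OF \<Lambda> X(1) a]
      norm_quasi_regular_le_left_regular[OF assms(1) X(1) group_algebra_subgroup(2)[OF \<Lambda> a]]
      norm_left_regular_subgroup[OF \<Lambda> a] by simp
qed

section \<open>The density argument\<close>

theorem increasing_union_density_sets:
  fixes \<Lambda> :: "nat \<Rightarrow> 'a set"
  assumes am: "amenable G" and \<Lambda>: "\<And>n. subgroup (\<Lambda> n) G" "\<And>n. \<Lambda> n \<subseteq> \<Lambda> (Suc n)"
    and union: "carrier G = (\<Union>n. \<Lambda> n)"
    and closed: "closedin (chabauty G) \<X>" and conj: "conjugation_invariant G \<X>"
    and dense: "\<And>n. (\<lambda>X. \<Lambda> n \<inter> X) ` \<X> \<in> density_sets (G\<lparr>carrier := \<Lambda> n\<rparr>)"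
  shows "\<X> \<in> density_sets G"
proof -
  let ?l = "algebra_rep (left_regular G)" and ?q = "\<lambda>X. algebra_rep (quasi_regular G X)"
  have sub: "subgroup X G" if "X \<in> \<X>" for X
    using closedin_subset[OF closed] that by (auto simp: topspace_chabauty)
  have le: "norm (?q X a) \<le> norm (?l a)" if "X \<in> \<X>" "a \<in> group_algebra G" for X a
    using am sub[OF that(1)] that(2) by (rule norm_quasi_regular_le_left_regular)
  have "J_ideal G \<X> \<subseteq> closure (J_ideal G \<X> \<inter> group_algebra_ops G)"
  proof
    fix T assume "T \<in> J_ideal G \<X>"
    then have T: "T \<in> reduced_cstar G" "\<And>X. X \<in> \<X> \<Longrightarrow> quasi_regular_ext G X T = 0"
      by (auto simp: J_ideal_iff)
    show "T \<in> closure (J_ideal G \<X> \<inter> group_algebra_ops G)"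
      unfolding closure_approachable
    proof (intro allI impI)
      fix e :: real assume e: "0 < e"
      \<comment> \<open>The errors add up to 6 \<epsilon>: one from \<open>T\<close> to
        \<open>a\<close>, four from \<open>a\<close> to the ideal element \<open>S\<close>, one from
        \<open>S\<close> to \<open>b\<close>.\<close>
      define \<epsilon> where "\<epsilon> = e / 8"
      have \<epsilon>: "0 < \<epsilon>" using e by (simp add: \<epsilon>_def)
      obtain a where a: "a \<in> group_algebra G" "norm (?l a - T) < \<epsilon>"
        using T(1) \<epsilon> unfolding reduced_cstar_def closure_approachable group_algebra_ops_def
        by (auto simp: dist_norm)
      have qa: "norm (?q X a) \<le> \<epsilon>" if "X \<in> \<X>" for X
        using norm_quasi_regular_ext_diff_le[OF le[OF that] T(1) a(1)] T(2)[OF that] a(2)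
        by (simp add: norm_minus_commute)
      have "finite {g. a g \<noteq> 0}" "{g. a g \<noteq> 0} \<subseteq> (\<Union>n. \<Lambda> n)"
        using a(1) union by (auto simp: group_algebra_def)
      then obtain n where n: "{g. a g \<noteq> 0} \<subseteq> \<Lambda> n"
        using finite_subset_incseq_UN[of "{g. a g \<noteq> 0}" \<Lambda>] \<Lambda>(2) by (auto simp: incseq_Suc_iff)
      let ?H = "G\<lparr>carrier := \<Lambda> n\<rparr>" and ?\<Y> = "(\<lambda>X. \<Lambda> n \<inter> X) ` \<X>"
      interpret H: group ?H using \<Lambda>(1) by (rule subgroup_imp_group)
      have aH: "a \<in> group_algebra ?H"
        using a(1) n by (auto simp: group_algebra_def)
      have subH: "subgroup Y ?H" if "Y \<in> ?\<Y>" for Y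
        using that sub \<Lambda>(1) by (auto intro!: subgroup_incl subgroups_Inter_pair)
      have leH: "norm (algebra_rep (quasi_regular ?H Y) b) \<le> norm (algebra_rep (left_regular ?H) b)"
        if "Y \<in> ?\<Y>" "b \<in> group_algebra ?H" for Y b
        using that sub \<Lambda>(1) am
        by (intro norm_quasi_regular_subgroup_le_left_regular) (auto intro!: subgroups_Inter_pair)
      have "norm (algebra_rep (quasi_regular ?H Y) a) \<le> \<epsilon>" if "Y \<in> ?\<Y>" for Y
        using that norm_quasi_regular_subgroup_le(1)[OF \<Lambda>(1) sub aH] qa by force
      from H.J_ideal_near[OF aH \<epsilon> subH this leH] obtain S
        where S: "S \<in> J_ideal ?H ?\<Y>" "norm (S - algebra_rep (left_regular ?H) a) \<le> 4 * \<epsilon>"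
        by blast
      have "S \<in> closure (J_ideal ?H ?\<Y> \<inter> group_algebra_ops ?H)"
        using S(1) dense[of n] unfolding density_sets_def by blast
      then obtain b where b: "b \<in> group_algebra ?H" "algebra_rep (left_regular ?H) b \<in> J_ideal ?H ?\<Y>"
        "norm (algebra_rep (left_regular ?H) b - S) < \<epsilon>"
        using \<epsilon> unfolding closure_approachable group_algebra_ops_def
        by (auto simp: dist_norm)
      have bG: "b \<in> group_algebra G" using \<Lambda>(1) b(1) by (rule group_algebra_subgroup(2))
      have "algebra_rep (quasi_regular ?H Y) b = 0" if "Y \<in> ?\<Y>" for Y
        using b(2) that H.quasi_regular_ext_props(2)[OF leH[OF that] b(1)] by (auto simp: H.J_ideal_iff)
      \<comment> \<open>The orbit bound with B = 0: conjugates of \<open>X\<close> stay in \<X>, so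
        \<open>b\<close> vanishes in every representation that occurs in the decomposition.\<close>
      then have "norm (?q X b) \<le> 0" if "X \<in> \<X>" for X
        using conj that by (intro norm_quasi_regular_subgroup_le(2)[OF \<Lambda>(1) sub[OF that] b(1)])
          (auto simp: conjugation_invariant_def)
      then have "?l b \<in> J_ideal G \<X>"
        using bG quasi_regular_ext_props(2)[OF le bG] closure_subset[of "group_algebra_ops G"]
        by (auto simp: J_ideal_iff reduced_cstar_def group_algebra_ops_def)
      moreover have "dist (?l b) T < e"
      proof -
        have "norm (?l b - ?l a) = norm (algebra_rep (left_regular ?H) b - algebra_rep (left_regular ?H) a)"
          using norm_left_regular_subgroup[OF \<Lambda>(1) group_algebra_diff[OF b(1) aH]]
          by (simp add: algebra_rep_diff[OF b(1) aH] algebra_rep_diff[OF bG a(1)])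
        also have "\<dots> \<le> norm (algebra_rep (left_regular ?H) b - S) + norm (S - algebra_rep (left_regular ?H) a)"
          by (rule norm_diff_triangle_le[OF order_refl order_refl])
        finally have "norm (?l b - ?l a) \<le> 5 * \<epsilon>" using b(3) S(2) by linarith
        then have "norm (?l b - T) \<le> 6 * \<epsilon>"
          using norm_diff_triangle_le[of "?l b" "?l a" "5 * \<epsilon>" T \<epsilon>] a(2) by simp
        then show ?thesis using e by (simp add: dist_norm \<epsilon>_def)
      qed
      ultimately show "\<exists>y\<in>J_ideal G \<X> \<inter> group_algebra_ops G. dist y T < e"
        using bG by (auto simp: group_algebra_ops_def)
    qed
  qed
  then show ?thesis using closed conj by (simp add: density_sets_def)
qed

end

section \<open>Restriction in the Chabauty topology\<close>

abbreviation indicator_topology :: "('a, 'b) monoid_scheme \<Rightarrow> ('a \<Rightarrow> nat) topology"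
  where "indicator_topology G \<equiv> product_topology (\<lambda>_. discrete_topology {0, 1}) (carrier G)"

abbreviation indicator_on :: "('a, 'b) monoid_scheme \<Rightarrow> 'a set \<Rightarrow> 'a \<Rightarrow> nat"
  where "indicator_on G X \<equiv> restrict (indicator X) (carrier G)"

lemma closedin_coordinate:
  assumes "x \<in> carrier G"
  shows "closedin (indicator_topology G) {f \<in> topspace (indicator_topology G). f x \<in> V}"
proof -
  have "closedin (discrete_topology {0, 1 :: nat}) (V \<inter> {0, 1})" by simp
  from closedin_continuous_map_preimage[OF continuous_map_product_projection[OF assms] this]
  have "closedin (indicator_topology G) {f \<in> topspace (indicator_topology G). f x \<in> V \<inter> {0, 1}}" .
  moreover have "{f \<in> topspace (indicator_topology G). f x \<in> V \<inter> {0, 1}} =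
      {f \<in> topspace (indicator_topology G). f x \<in> V}"
    using assms by (auto simp: topspace_product_topology PiE_iff)
  ultimately show ?thesis by simp
qed

text \<open>Each single instance of a subgroup axiom constrains at most three coordinates, which is
  what makes the set of subgroups closed in the product.\<close>

lemma (in group) indicator_on_subgroups:
  "indicator_on G ` {X. subgroup X G} = {f \<in> topspace (indicator_topology G). f \<one> = 1 \<and>
    (\<forall>x\<in>carrier G. f x = 1 \<longrightarrow> f (inv x) = 1) \<and>
    (\<forall>x\<in>carrier G. \<forall>y\<in>carrier G. f x = 1 \<longrightarrow> f y = 1 \<longrightarrow> f (x \<otimes> y) = 1)}" (is "?L = ?R")
proof
  show "?L \<subseteq> ?R"
  proof
    fix f assume "f \<in> ?L"
    then obtain X where X: "subgroup X G" and f: "f = indicator_on G X" by blast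
    have one: "f x = 1 \<longleftrightarrow> x \<in> X" if "x \<in> carrier G" for x
      using that by (cases "x \<in> X") (simp_all add: f)
    have "f \<in> topspace (indicator_topology G)"
      by (auto simp: f indicator_def)
    then show "f \<in> ?R"
      using X one by (simp add: subgroup.one_closed subgroup.m_inv_closed subgroup.m_closed)
  qed
  show "?R \<subseteq> ?L"
  proof
    fix f assume f: "f \<in> ?R"
    have "subgroup {x \<in> carrier G. f x = 1} G"
      using f by unfold_locales auto
    moreover have "f = indicator_on G {x \<in> carrier G. f x = 1}"
      using f by (auto simp: fun_eq_iff PiE_iff extensional_def indicator_def)
    ultimately show "f \<in> ?L" by blast
  qed
qed

lemma (in group) closedin_indicator_on_subgroups:
  "closedin (indicator_topology G) (indicator_on G ` {X. subgroup X G})"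
proof -
  let ?A = "\<lambda>x V. {f \<in> topspace (indicator_topology G). f x \<in> V}"
  have eq: "indicator_on G ` {X. subgroup X G} = ?A \<one> {1} \<inter>
      (\<Inter>x\<in>carrier G. ?A x (- {1}) \<union> ?A (inv x) {1}) \<inter>
      (\<Inter>x\<in>carrier G. \<Inter>y\<in>carrier G. ?A x (- {1}) \<union> ?A y (- {1}) \<union> ?A (x \<otimes> y) {1})"
    unfolding indicator_on_subgroups using one_closed by (auto simp del: topspace_product_topology)
  show ?thesis
    unfolding eq
    by (intro closedin_Int closedin_INT closedin_Un closedin_coordinate one_closed inv_closed m_closed) auto
qed

text \<open>The pullback topology gives closedness relative to the image of all subgroups; that
  image is itself closed in the product.\<close>

lemma (in group) closedin_indicator_on:
  assumes "closedin (chabauty G) \<X>"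
  shows "closedin (indicator_topology G) (indicator_on G ` \<X>)"
proof -
  have sub: "\<X> \<subseteq> {X. subgroup X G}"
    using closedin_subset[OF assms] by (simp add: topspace_chabauty)
  have "openin (chabauty G) ({X. subgroup X G} - \<X>)"
    using assms by (simp add: closedin_def topspace_chabauty)
  then obtain U where U: "openin (indicator_topology G) U"
    "{X. subgroup X G} - \<X> = indicator_on G -` U \<inter> {X. subgroup X G}"
    unfolding chabauty_def openin_pullback_topology by blast
  have "indicator_on G ` \<X> = indicator_on G ` {X. subgroup X G} - U"
    using U(2) sub by blast
  then show ?thesis
    using closedin_diff[OF closedin_indicator_on_subgroups U(1)] by simp
qed

text \<open>A continuous image of a closed set need not be closed. Here Tychonoff compactness over
  \<open>G\<close> makes the image compact, and the Hausdorff property over \<Lambda> makes it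
  closed.\<close>

lemma (in group) closedin_chabauty_Int:
  assumes \<Lambda>: "subgroup \<Lambda> G" and \<X>: "closedin (chabauty G) \<X>"
  shows "closedin (chabauty (G\<lparr>carrier := \<Lambda>\<rparr>)) ((\<lambda>X. \<Lambda> \<inter> X) ` \<X>)"
proof -
  let ?H = "G\<lparr>carrier := \<Lambda>\<rparr>"
  have \<Lambda>G: "\<Lambda> \<subseteq> carrier G" using \<Lambda> by (rule subgroup.subset)
  have sub: "subgroup X G" if "X \<in> \<X>" for X
    using closedin_subset[OF \<X>] that by (auto simp: topspace_chabauty)
  define C where "C = (\<lambda>f. restrict f \<Lambda>) ` indicator_on G ` \<X>"
  have "compact_space (indicator_topology G)"
    by (auto simp: compact_space_product_topology compact_space_discrete_topology)
  then have "compactin (indicator_topology G) (indicator_on G ` \<X>)"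
    using closedin_indicator_on[OF \<X>] by (rule closedin_compact_space)
  moreover have "continuous_map (indicator_topology G) (indicator_topology ?H) (\<lambda>f. restrict f \<Lambda>)"
    using \<Lambda>G by (auto simp: continuous_map_componentwise intro!: continuous_map_product_projection)
  ultimately have "compactin (indicator_topology ?H) C"
    unfolding C_def by (rule image_compactin)
  then have "closedin (indicator_topology ?H) C"
    by (intro compactin_imp_closedin) (simp_all add: Hausdorff_space_product_topology)
  moreover have "continuous_map (chabauty ?H) (indicator_topology ?H) (id \<circ> indicator_on ?H)"
    unfolding chabauty_def by (intro continuous_map_pullback) simp
  ultimately have "closedin (chabauty ?H) {Y \<in> topspace (chabauty ?H). indicator_on ?H Y \<in> C}"
    using closedin_continuous_map_preimage by fastforce
  also have "{Y \<in> topspace (chabauty ?H). indicator_on ?H Y \<in> C} = (\<lambda>X. \<Lambda> \<inter> X) ` \<X>"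
  proof -
    have ind: "restrict (indicator_on G X) \<Lambda> = indicator_on ?H (\<Lambda> \<inter> X)" for X
      using \<Lambda>G by (auto simp: fun_eq_iff indicator_def)
    have inj: "Y = Z" if "indicator_on ?H Y = indicator_on ?H Z" "Y \<subseteq> \<Lambda>" "Z \<subseteq> \<Lambda>" for Y Z
    proof -
      have "x \<in> Y \<longleftrightarrow> x \<in> Z" if "x \<in> \<Lambda>" for x
        using fun_cong[OF \<open>indicator_on ?H Y = indicator_on ?H Z\<close>, of x] that
        by (cases "x \<in> Y"; cases "x \<in> Z") simp_all
      then show ?thesis using that by blast
    qed
    have subH: "subgroup (\<Lambda> \<inter> X) ?H" if "X \<in> \<X>" for X
      using that sub \<Lambda> by (auto intro!: subgroup_incl subgroups_Inter_pair)
    have C: "C = (\<lambda>X. indicator_on ?H (\<Lambda> \<inter> X)) ` \<X>"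
      unfolding C_def image_image ind ..
    show ?thesis
    proof (intro equalityI subsetI)
      fix Y assume "Y \<in> {Y \<in> topspace (chabauty ?H). indicator_on ?H Y \<in> C}"
      then obtain X where X: "X \<in> \<X>" "indicator_on ?H Y = indicator_on ?H (\<Lambda> \<inter> X)" "subgroup Y ?H"
        unfolding C topspace_chabauty by blast
      have "Y \<subseteq> \<Lambda>" using subgroup.subset[OF X(3)] by simp
      then have "Y = \<Lambda> \<inter> X" using X(2) by (intro inj) auto
      then show "Y \<in> (\<lambda>X. \<Lambda> \<inter> X) ` \<X>" using X(1) by blast
    next
      fix Y assume "Y \<in> (\<lambda>X. \<Lambda> \<inter> X) ` \<X>"
      then show "Y \<in> {Y \<in> topspace (chabauty ?H). indicator_on ?H Y \<in> C}"
        unfolding C topspace_chabauty using subH by blast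
    qed
  qed
  finally show ?thesis .
qed

text \<open>Conjugation by an element of \<Lambda> preserves \<Lambda>, so it commutes with
  intersecting with \<Lambda>.\<close>

lemma (in group) conjugation_invariant_Int:
  assumes \<Lambda>: "subgroup \<Lambda> G" and \<X>: "\<And>X. X \<in> \<X> \<Longrightarrow> subgroup X G" "conjugation_invariant G \<X>"
  shows "conjugation_invariant (G\<lparr>carrier := \<Lambda>\<rparr>) ((\<lambda>X. \<Lambda> \<inter> X) ` \<X>)"
  unfolding conjugation_invariant_def
proof safe
  let ?H = "G\<lparr>carrier := \<Lambda>\<rparr>"
  interpret H: group ?H using \<Lambda> by (rule subgroup_imp_group)
  fix X g assume X: "X \<in> \<X>" and "g \<in> carrier ?H"
  then have g: "g \<in> \<Lambda>" "g \<in> carrier G" using subgroup.subset[OF \<Lambda>] by auto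
  have XG: "X \<subseteq> carrier G" using \<X>(1)[OF X] by (rule subgroup.subset)
  have inv: "inv\<^bsub>?H\<^esub> g = inv g" "inv g \<in> \<Lambda>"
    using \<Lambda> g(1) by (simp_all add: m_inv_consistent subgroup.m_inv_closed)
  have "h \<in> g <#\<^bsub>?H\<^esub> (\<Lambda> \<inter> X) #>\<^bsub>?H\<^esub> inv\<^bsub>?H\<^esub> g \<longleftrightarrow> h \<in> \<Lambda> \<inter> (g <#\<^bsub>G\<^esub> X #>\<^bsub>G\<^esub> inv g)" for h
  proof (cases "h \<in> \<Lambda>")
    case True
    then show ?thesis
      using H.mem_conjugate_iff[of "\<Lambda> \<inter> X" g h] mem_conjugate_iff[OF XG g(2), of h] g inv
        subgroup.subset[OF \<Lambda>] \<Lambda> by (auto simp: subgroup.m_closed)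
  next
    case False
    have "g <#\<^bsub>?H\<^esub> (\<Lambda> \<inter> X) #>\<^bsub>?H\<^esub> inv\<^bsub>?H\<^esub> g \<subseteq> carrier ?H"
      using g inv by (intro H.r_coset_subset_G H.l_coset_subset_G) auto
    then show ?thesis using False by auto
  qed
  then have "g <#\<^bsub>?H\<^esub> (\<Lambda> \<inter> X) #>\<^bsub>?H\<^esub> inv\<^bsub>?H\<^esub> g = \<Lambda> \<inter> (g <#\<^bsub>G\<^esub> X #>\<^bsub>G\<^esub> inv g)"
    by blast
  moreover have "g <#\<^bsub>G\<^esub> X #>\<^bsub>G\<^esub> inv g \<in> \<X>"
    using \<X>(2) X g(2) by (auto simp: conjugation_invariant_def)
  ultimately show "g <#\<^bsub>?H\<^esub> (\<Lambda> \<inter> X) #>\<^bsub>?H\<^esub> inv\<^bsub>?H\<^esub> g \<in> (\<lambda>X. \<Lambda> \<inter> X) ` \<X>"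
    by blast
qed

theorem proposition4p10:
  fixes G :: "('a, 'b) monoid_scheme" and \<Lambda> :: "nat \<Rightarrow> 'a set"
  assumes "group G" and "amenable G"
    and "\<And>n. subgroup (\<Lambda> n) G"
    and "\<And>n. \<Lambda> n \<subseteq> \<Lambda> (Suc n)"
    and "carrier G = (\<Union>n. \<Lambda> n)"
  shows "(\<forall>\<X>. closedin (chabauty G) \<X> \<and> conjugation_invariant G \<X> \<and>
        (\<forall>n. (\<lambda>X. \<Lambda> n \<inter> X) ` \<X> \<in> density_sets (G\<lparr>carrier := \<Lambda> n\<rparr>))
        \<longrightarrow> \<X> \<in> density_sets G)
    \<and> ((\<forall>n. density_property (G\<lparr>carrier := \<Lambda> n\<rparr>)) \<longrightarrow> density_property G)"
proof -
  interpret group G by fact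
  have dense: "\<X> \<in> density_sets G"
    if "closedin (chabauty G) \<X>" "conjugation_invariant G \<X>"
      "\<forall>n. (\<lambda>X. \<Lambda> n \<inter> X) ` \<X> \<in> density_sets (G\<lparr>carrier := \<Lambda> n\<rparr>)" for \<X>
    using assms(2-5) that by (intro increasing_union_density_sets) auto
  moreover have "density_property G" if "\<forall>n. density_property (G\<lparr>carrier := \<Lambda> n\<rparr>)"
    unfolding density_property_def
  proof (intro allI impI, elim conjE)
    fix \<X> assume \<X>: "closedin (chabauty G) \<X>" "conjugation_invariant G \<X>"
    then have "subgroup X G" if "X \<in> \<X>" for X
      using closedin_subset[OF \<X>(1)] that by (auto simp: topspace_chabauty)
    \<comment> \<open>The Density Property of the subgroup speaks of closed, conjugation-invariant
      sets, so both properties are transferred to the traces.\<close>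
    then have "(\<lambda>X. \<Lambda> n \<inter> X) ` \<X> \<in> density_sets (G\<lparr>carrier := \<Lambda> n\<rparr>)" for n
      using that closedin_chabauty_Int[OF assms(3) \<X>(1), of n] conjugation_invariant_Int[OF assms(3) _ \<X>(2), of n]
      unfolding density_property_def by blast
    then show "\<X> \<in> density_sets G" using dense \<X> by blast
  qed
  ultimately show ?thesis by blast
qed

end
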